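(* Let $k$ be a field of characteristic $0$. The base rank of the variety $\mathfrak{N}$ of Novikov algebras over $k$ is equal to one.
   Context: Algebras are $k$-vector spaces with a $k$-bilinear multiplication, not assumed associative or unital. A Novikov algebra is an algebra satisfying the identities $(xy)z-x(yz)=(xz)y-x(zy)$ and $x(yz)=y(xz)$; $\mathfrak{N}$ is the variety of all Novikov algebras over $k$. $\mathrm{N}\langle x_1,\ldots,x_n\rangle$ denotes the free (non-unital) Novikov algebra over $k$ on $x_1,\ldots,x_n$. For an algebra $B$, $\mathrm{Var}(B)$ denotes the variety of algebras generated by $B$, i.e. the class of all $k$-algebras satisfying every polynomial identity satisfied by $B$. The base rank of $\mathfrak{N}$ is the least natural number $n\ge 1$ such that $\mathrm{Var}(\mathrm{N}\langle x_1,\ldots,x_n\rangle)=\mathfrak{N}$. *)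

theory Defs
  imports
    "HOL-Algebra.QuotRing"
    "HOL-Algebra.Module"
    "HOL-Algebra.Algebraic_Closure_Type"
    "HOL-Library.Poly_Mapping"
    "HOL-Library.Extended_Nat"
begin

text \<open>
  Algebras over the field \<open>'k\<close> live in the record type of \<^theory>\<open>HOL-Algebra.Module\<close>, whose
  scalars are here the whole type \<open>'k\<close>. The \<open>one\<close> field of that record is never referred to:
  algebras need be neither unital nor associative.
\<close>

locale nonassoc_algebra =
  module "ring_of_type_algebra :: 'k::field ring" A for A :: "('k::field, 'a) module" +
  assumes mult_closed:
      "\<And>x y. \<lbrakk>x \<in> carrier A; y \<in> carrier A\<rbrakk> \<Longrightarrow> x \<otimes>\<^bsub>A\<^esub> y \<in> carrier A"
    and mult_add_left:
      "\<And>x y z. \<lbrakk>x \<in> carrier A; y \<in> carrier A; z \<in> carrier A\<rbrakk> \<Longrightarrow>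
        (x \<oplus>\<^bsub>A\<^esub> y) \<otimes>\<^bsub>A\<^esub> z = x \<otimes>\<^bsub>A\<^esub> z \<oplus>\<^bsub>A\<^esub> y \<otimes>\<^bsub>A\<^esub> z"
    and mult_add_right:
      "\<And>x y z. \<lbrakk>x \<in> carrier A; y \<in> carrier A; z \<in> carrier A\<rbrakk> \<Longrightarrow>
        x \<otimes>\<^bsub>A\<^esub> (y \<oplus>\<^bsub>A\<^esub> z) = x \<otimes>\<^bsub>A\<^esub> y \<oplus>\<^bsub>A\<^esub> x \<otimes>\<^bsub>A\<^esub> z"
    and mult_smult_left:
      "\<And>c x y. \<lbrakk>x \<in> carrier A; y \<in> carrier A\<rbrakk> \<Longrightarrow>
        (c \<odot>\<^bsub>A\<^esub> x) \<otimes>\<^bsub>A\<^esub> y = c \<odot>\<^bsub>A\<^esub> (x \<otimes>\<^bsub>A\<^esub> y)"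
    and mult_smult_right:
      "\<And>c x y. \<lbrakk>x \<in> carrier A; y \<in> carrier A\<rbrakk> \<Longrightarrow>
        x \<otimes>\<^bsub>A\<^esub> (c \<odot>\<^bsub>A\<^esub> y) = c \<odot>\<^bsub>A\<^esub> (x \<otimes>\<^bsub>A\<^esub> y)"

definition novikov_variety :: "('k::field, 'a) module set" where
  "novikov_variety = {A. nonassoc_algebra A \<and>
    (\<forall>x\<in>carrier A. \<forall>y\<in>carrier A. \<forall>z\<in>carrier A.
      (x \<otimes>\<^bsub>A\<^esub> y) \<otimes>\<^bsub>A\<^esub> z \<ominus>\<^bsub>A\<^esub> x \<otimes>\<^bsub>A\<^esub> (y \<otimes>\<^bsub>A\<^esub> z) =
        (x \<otimes>\<^bsub>A\<^esub> z) \<otimes>\<^bsub>A\<^esub> y \<ominus>\<^bsub>A\<^esub> x \<otimes>\<^bsub>A\<^esub> (z \<otimes>\<^bsub>A\<^esub> y) \<and>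
      x \<otimes>\<^bsub>A\<^esub> (y \<otimes>\<^bsub>A\<^esub> z) = y \<otimes>\<^bsub>A\<^esub> (x \<otimes>\<^bsub>A\<^esub> z))}"


subsection \<open>Nonassociative polynomials and polynomial identities\<close>

datatype (letters: 'x) nonassoc_word =
  Letter 'x
| Juxt "'x nonassoc_word" "'x nonassoc_word"

type_synonym ('x, 'k) nonassoc_poly = "'x nonassoc_word \<Rightarrow>\<^sub>0 'k"

primrec eval_word :: "('k, 'a) module \<Rightarrow> ('x \<Rightarrow> 'a) \<Rightarrow> 'x nonassoc_word \<Rightarrow> 'a" where
  "eval_word A \<rho> (Letter x) = \<rho> x"
| "eval_word A \<rho> (Juxt u v) = eval_word A \<rho> u \<otimes>\<^bsub>A\<^esub> eval_word A \<rho> v"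

definition eval_poly :: "('k::field, 'a) module \<Rightarrow> ('x \<Rightarrow> 'a) \<Rightarrow> ('x, 'k) nonassoc_poly \<Rightarrow> 'a" where
  "eval_poly A \<rho> f =
    (\<Oplus>\<^bsub>A\<^esub>w\<in>Poly_Mapping.keys f. Poly_Mapping.lookup f w \<odot>\<^bsub>A\<^esub> eval_word A \<rho> w)"

text \<open>Countably many variables suffice: a polynomial involves only finitely many.\<close>

definition satisfies_identity :: "('k::field, 'a) module \<Rightarrow> (nat, 'k) nonassoc_poly \<Rightarrow> bool" where
  "satisfies_identity A f \<longleftrightarrow>
    (\<forall>\<rho>. (\<forall>i. \<rho> i \<in> carrier A) \<longrightarrow> eval_poly A \<rho> f = \<zero>\<^bsub>A\<^esub>)"

text \<open>
  The generating algebra and the members of the variety may have different types of elements.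
\<close>

definition variety_generated_by :: "('k::field, 'b) module \<Rightarrow> ('k, 'a) module set" where
  "variety_generated_by B =
    {A. nonassoc_algebra A \<and> (\<forall>f. satisfies_identity B f \<longrightarrow> satisfies_identity A f)}"


subsection \<open>Free Novikov algebras\<close>

definition nonassoc_poly_mult ::
  "('x, 'k::field) nonassoc_poly \<Rightarrow> ('x, 'k) nonassoc_poly \<Rightarrow> ('x, 'k) nonassoc_poly" where
  "nonassoc_poly_mult f g = (\<Sum>u\<in>Poly_Mapping.keys f. \<Sum>v\<in>Poly_Mapping.keys g.
    Poly_Mapping.single (Juxt u v) (Poly_Mapping.lookup f u * Poly_Mapping.lookup g v))"

definition free_nonassoc_algebra :: "'x set \<Rightarrow> ('k::field, ('x, 'k) nonassoc_poly) module" where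
  "free_nonassoc_algebra V =
    \<lparr>carrier = {f. \<forall>w\<in>Poly_Mapping.keys f. letters w \<subseteq> V},
     monoid.mult = nonassoc_poly_mult, one = undefined, zero = 0, add = (+),
     module.smult = (\<lambda>c. Poly_Mapping.map ((*) c))\<rparr>"

definition algebra_ideal :: "'a set \<Rightarrow> ('k::field, 'a) module \<Rightarrow> bool" where
  "algebra_ideal I A \<longleftrightarrow> submodule I (ring_of_type_algebra :: 'k ring) A \<and>
    (\<forall>a\<in>carrier A. \<forall>x\<in>I. a \<otimes>\<^bsub>A\<^esub> x \<in> I \<and> x \<otimes>\<^bsub>A\<^esub> a \<in> I)"

definition generated_ideal :: "('k::field, 'a) module \<Rightarrow> 'a set \<Rightarrow> 'a set" where
  "generated_ideal A S = \<Inter>{I. algebra_ideal I A \<and> S \<subseteq> I}"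

definition quotient_algebra :: "('k::field, 'a) module \<Rightarrow> 'a set \<Rightarrow> ('k, 'a set) module" where
  "quotient_algebra A I =
    \<lparr>carrier = a_rcosets\<^bsub>A\<^esub> I, monoid.mult = rcoset_mult A I, one = undefined, zero = I,
     add = set_add A, module.smult = (\<lambda>c C. \<Union>x\<in>C. I +>\<^bsub>A\<^esub> (c \<odot>\<^bsub>A\<^esub> x))\<rparr>"

definition novikov_relators :: "('k::field, 'a) module \<Rightarrow> 'a set" where
  "novikov_relators A =
    {((x \<otimes>\<^bsub>A\<^esub> y) \<otimes>\<^bsub>A\<^esub> z \<ominus>\<^bsub>A\<^esub> x \<otimes>\<^bsub>A\<^esub> (y \<otimes>\<^bsub>A\<^esub> z)) \<ominus>\<^bsub>A\<^esub>
     ((x \<otimes>\<^bsub>A\<^esub> z) \<otimes>\<^bsub>A\<^esub> y \<ominus>\<^bsub>A\<^esub> x \<otimes>\<^bsub>A\<^esub> (z \<otimes>\<^bsub>A\<^esub> y)) | x y z.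
       x \<in> carrier A \<and> y \<in> carrier A \<and> z \<in> carrier A} \<union>
    {x \<otimes>\<^bsub>A\<^esub> (y \<otimes>\<^bsub>A\<^esub> z) \<ominus>\<^bsub>A\<^esub> y \<otimes>\<^bsub>A\<^esub> (x \<otimes>\<^bsub>A\<^esub> z) | x y z.
       x \<in> carrier A \<and> y \<in> carrier A \<and> z \<in> carrier A}"

definition free_novikov_algebra ::
  "'x set \<Rightarrow> ('k::field, ('x, 'k) nonassoc_poly set) module" where
  "free_novikov_algebra V =
    quotient_algebra (free_nonassoc_algebra V)
      (generated_ideal (free_nonassoc_algebra V) (novikov_relators (free_nonassoc_algebra V)))"


subsection \<open>Base rank\<close>

text \<open>
  HOL has no class of all algebras over \<open>'k\<close>, so varieties are compared among the algebras whose
  elements have a given type \<open>'a\<close>; a statement with \<open>'a\<close> a type variable covers all algebras.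
  Already for \<open>'a = (nat, 'k) nonassoc_poly set\<close>, which contains the free Novikov
  algebra of countable rank, two varieties of Novikov algebras agree on \<open>'a\<close> only if they are
  equal. The infimum is taken in \<^typ>\<open>enat\<close>, so that it is \<open>\<infinity>\<close>, not a junk number, if no
  finitely generated free algebra generates the variety.
\<close>

definition novikov_base_rank :: "'k::field itself \<Rightarrow> 'a itself \<Rightarrow> enat" where
  "novikov_base_rank _ _ = Inf {enat n | n. n \<ge> 1 \<and>
    variety_generated_by (free_novikov_algebra {..<n} :: ('k, (nat, 'k) nonassoc_poly set) module)
      = (novikov_variety :: ('k, 'a) module set)}"

end

theory Submission
  imports Defs "HOL-Library.Multiset"
begin

text \<open>
  The guiding model of a Novikov algebra is a commutative algebra with a derivation \<open>d\<close> and the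
  product \<open>p q = d(p) \<cdot> q\<close>: then \<open>p(qr) = d(p) d(q) r\<close> is symmetric in \<open>p, q\<close>, and
  \<open>(pq)r - p(qr) = d(d(p)) q r\<close> is symmetric in \<open>q, r\<close>. Reading letters as differential variables
  turns a nonassociative polynomial \<open>f\<close> into a differential polynomial \<open>to_diff f\<close>. The one-generated
  free Novikov algebra generates the whole variety because the identities of both are the
  polynomials \<open>f\<close> with \<open>to_diff f = 0\<close>.

  If \<open>to_diff f = 0\<close>, then \<open>f\<close> holds in every Novikov algebra (\<open>novikov_identity_holds\<close>). A word of
  length \<open>n\<close> becomes a sum of monomials with \<open>n\<close> factors and \<open>n - 1\<close> derivatives, here called
  admissible. Conversely an admissible monomial has a value in an arbitrary Novikov algebra: the
  operations \<open>x{z\<^sub>1,\<dots>,z\<^sub>n}\<close> which stand for \<open>x\<^sup>(\<^sup>n\<^sup>)z\<^sub>1\<cdots>z\<^sub>n\<close> (braces) exist in every right-symmetric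
  algebra and are symmetric in the \<open>z\<^sub>i\<close>; left-commutativity makes the operators
  \<open>u \<mapsto> x{u,z\<^sub>2,\<dots>,z\<^sub>n}\<close> commute with left multiplications and hence with each other. So a nested
  brace depends only on the multiset of its factors (\<open>eval_blocks_cong\<close>), and the resulting map
  \<open>eval_monomial\<close> turns \<open>d(p) \<cdot> q\<close> into the product of the values (\<open>eval_monomial_mul\<close>). Applied to the
  free Novikov algebra on all letters, it recovers the class of \<open>f\<close> from \<open>to_diff f\<close>
  (\<open>from_diff_to_diff\<close>).

  If \<open>f\<close> is an identity of the free Novikov algebra on one letter \<open>x\<close>, then \<open>to_diff f = 0\<close>
  (\<open>to_diff_identity\<close>). That algebra contains, for every \<open>n\<close>, an element whose differential
  polynomial is \<open>x\<^sup>n x\<^sup>(\<^sup>n\<^sup>)\<close>. Up to terms with at least two derived factors, the \<open>j\<close>-th derivative of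
  \<open>x\<^sup>n x\<^sup>(\<^sup>n\<^sup>)\<close> is \<open>x\<^sup>n x\<^sup>(\<^sup>n\<^sup>+\<^sup>j\<^sup>)\<close>. If the exponents \<open>n\<^sub>i\<close> are spaced more widely than the orders in
  \<open>to_diff f\<close>, the leading terms \<open>x\<^sup>n\<^sup>i x\<^sup>(\<^sup>n\<^sup>i\<^sup>+\<^sup>j\<^sup>)\<close> involve distinct derivatives of \<open>x\<close>, and substituting
  \<open>x\<^sup>n\<^sup>i x\<^sup>(\<^sup>n\<^sup>i\<^sup>)\<close> for the \<open>i\<close>-th letter keeps a nonzero \<open>to_diff f\<close> nonzero (\<open>diff_subst_faithful\<close>).
\<close>

section \<open>Braces in a Novikov algebra\<close>

lemma add_mset_diff_single: "z \<in># M \<Longrightarrow> add_mset a M - {#z#} = add_mset a (M - {#z#})"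
  by (metis add_mset_commute add_mset_remove_trivial insert_DiffM)

lemma Suc_length_remove1: "z \<in> set Z \<Longrightarrow> Suc (length (remove1 z Z)) = length Z"
  by (metis One_nat_def Suc_pred length_pos_if_in_set length_remove1)

text \<open>
  Both sides run over the ordered pairs of different positions in \<open>M\<close>; this is what makes the double
  sum in the expansion of a brace symmetric.
\<close>

lemma sum_mset_pairs_swap:
  fixes g :: "'a \<Rightarrow> 'a \<Rightarrow> 'b::comm_monoid_add"
  shows "(\<Sum>z\<in>#M. \<Sum>y\<in>#M - {#z#}. g z y) = (\<Sum>z\<in>#M. \<Sum>y\<in>#M - {#z#}. g y z)"
proof (induction M)
  case (add a M)
  have *: "(\<Sum>z\<in>#add_mset a M. \<Sum>y\<in>#add_mset a M - {#z#}. h z y) =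
      (\<Sum>y\<in>#M. h a y) + (\<Sum>z\<in>#M. h z a) + (\<Sum>z\<in>#M. \<Sum>y\<in>#M - {#z#}. h z y)"
    for h :: "'a \<Rightarrow> 'a \<Rightarrow> 'b"
  proof -
    have "(\<Sum>z\<in>#M. \<Sum>y\<in>#add_mset a M - {#z#}. h z y) =
        (\<Sum>z\<in>#M. h z a + (\<Sum>y\<in>#M - {#z#}. h z y))"
      by (intro arg_cong[where f = sum_mset] image_mset_cong)
        (simp add: add_mset_diff_single)
    then show ?thesis by (simp add: sum_mset.distrib add.assoc)
  qed
  show ?case unfolding * using add by (simp add: add_ac)
qed simp

locale novikov_product =
  fixes mul :: "'a::ab_group_add \<Rightarrow> 'a \<Rightarrow> 'a" (infixl "\<star>" 70)
  assumes distrib_right: "(x + y) \<star> z = x \<star> z + y \<star> z"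
    and distrib_left: "x \<star> (y + z) = x \<star> y + x \<star> z"
    and right_symmetric: "(x \<star> y) \<star> z - x \<star> (y \<star> z) = (x \<star> z) \<star> y - x \<star> (z \<star> y)"
    and left_commutative: "x \<star> (y \<star> z) = y \<star> (x \<star> z)"
begin

lemma mul_zero_left [simp]: "0 \<star> z = 0"
  using distrib_right[of 0 0 z] by simp

lemma mul_zero_right [simp]: "z \<star> 0 = 0"
  using distrib_left[of z 0 0] by simp

lemma diff_mul: "(x - y) \<star> z = x \<star> z - y \<star> z"
  using distrib_right[of "x - y" y z] by (simp add: algebra_simps)

lemma sum_mset_mul: "(\<Sum>z\<in>#M. f z) \<star> w = (\<Sum>z\<in>#M. f z \<star> w)"
  by (induction M) (simp_all add: distrib_right)

lemma sum_mset_subtractf: "(\<Sum>z\<in>#M. f z - g z) = (\<Sum>z\<in>#M. f z) - (\<Sum>z\<in>#M. g z :: 'a)"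
  by (induction M) (simp_all add: algebra_simps)

text \<open>
  In the differential model the brace is \<open>x\<^sup>(\<^sup>n\<^sup>)\<close> times the product of the list \<open>Z\<close> of length \<open>n\<close>. The
  recursion is the Leibniz rule for \<open>d(x\<^sup>(\<^sup>n\<^sup>)z\<^sub>1\<cdots>z\<^sub>n) w\<close>, solved for the summand in which the
  derivation hits \<open>x\<^sup>(\<^sup>n\<^sup>)\<close>; in the other summands \<open>d(z\<^sub>i)\<close> and \<open>w\<close> combine to \<open>z\<^sub>i \<star> w\<close>.
\<close>

function list_brace :: "'a list \<Rightarrow> 'a \<Rightarrow> 'a" where
  "list_brace [] x = x"
| "list_brace (w # Z) x =
    list_brace Z x \<star> w - (\<Sum>z\<leftarrow>Z. list_brace ((z \<star> w) # remove1 z Z) x)"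
  by pat_completeness auto
termination
  by (relation "measure (\<lambda>(Z, x). length Z)") (auto simp: Suc_length_remove1)

declare list_brace.simps(2) [simp del]

lemma list_brace_add: "list_brace ((u + v) # Z) x = list_brace (u # Z) x + list_brace (v # Z) x"
proof (induction Z arbitrary: u v rule: measure_induct_rule[where f = length])
  case (less Z)
  have "list_brace ((z \<star> u + z \<star> v) # remove1 z Z) x =
      list_brace ((z \<star> u) # remove1 z Z) x + list_brace ((z \<star> v) # remove1 z Z) x"
    if "z \<in> set Z" for z
    using less[of "remove1 z Z"] Suc_length_remove1[OF that] by simp
  then have "(\<Sum>z\<leftarrow>Z. list_brace ((z \<star> (u + v)) # remove1 z Z) x) =
      (\<Sum>z\<leftarrow>Z. list_brace ((z \<star> u) # remove1 z Z) x + list_brace ((z \<star> v) # remove1 z Z) x)"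
    by (intro arg_cong[where f = sum_list] map_cong refl) (simp add: distrib_left)
  then show ?case
    unfolding list_brace.simps(2)[of _ Z x] by (simp add: distrib_left sum_list_addf)
qed

text \<open>
  Symmetry of the brace rests on right-symmetry alone. Expanding the recursion twice, the brace of
  \<open>w, v, Y\<close> becomes a sum of terms each of which is visibly symmetric in \<open>v\<close> and \<open>w\<close> or is so by
  right-symmetry; the induction on the length allows all shorter braces to be read as functions \<open>G\<close>
  of a multiset.
\<close>

lemma list_brace_cong:
  assumes "mset Z = mset Z'"
  shows "list_brace Z x = list_brace Z' x"
proof -
  have "\<forall>Z Z'. length Z \<le> n \<longrightarrow> mset Z = mset Z' \<longrightarrow> list_brace Z x = list_brace Z' x" for n
  proof (induction n)
    case (Suc n)
    define G where "G M = list_brace (SOME Z. mset Z = M) x" for M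
    have G: "list_brace Z x = G (mset Z)" if "length Z \<le> n" for Z
      unfolding G_def using Suc that by (metis (mono_tags) someI_ex)
    have rec: "list_brace (w # Z) x = G (mset Z) \<star> w -
        (\<Sum>z\<in>#mset Z. G (add_mset (z \<star> w) (mset Z - {#z#})))" if "length Z \<le> n" for w Z
    proof -
      have *: "map (\<lambda>z. list_brace ((z \<star> w) # remove1 z Z) x) Z =
          map (\<lambda>z. G (add_mset (z \<star> w) (mset Z - {#z#}))) Z"
        using that by (intro map_cong refl) (subst G, auto simp: Suc_length_remove1)
      have "sum_list (map f Z) = (\<Sum>z\<in>#mset Z. f z)" for f :: "'a \<Rightarrow> 'a"
        by (metis mset_map sum_mset_sum_list)
      then show ?thesis
        unfolding list_brace.simps(2)[of w Z x] * G[OF that] by simp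
    qed
    have Grec: "G (add_mset w M) = G M \<star> w - (\<Sum>z\<in>#M. G (add_mset (z \<star> w) (M - {#z#})))"
      if "size M < n" for w M
    proof -
      obtain Z where Z: "mset Z = M" using ex_mset by blast
      have "length Z < n" using that Z by (metis size_mset)
      then show ?thesis using rec[of Z w] G[of "w # Z"] Z by simp
    qed
    have cons: "list_brace (w # Z) x = list_brace (w # Z') x"
      if "length Z \<le> n" "mset Z = mset Z'" for w Z Z'
      using that rec[of Z w] rec[of Z' w] mset_eq_length[OF that(2)] by simp
    have swap: "list_brace (w # v # Y) x = list_brace (v # w # Y) x"
      if len: "Suc (length Y) \<le> n" for w v Y
    proof -
      define B where "B = mset Y"
      have sB: "size B < n" using len by (simp add: B_def)
      have Gadd: "G (add_mset (a + b) M) = G (add_mset a M) + G (add_mset b M)"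
        if "size M < n" for a b M
      proof -
        obtain Z where Z: "mset Z = M" using ex_mset by blast
        have "length Z < n" using that Z by (metis size_mset)
        then show ?thesis
          using list_brace_add[of a b Z x] G[of "a # Z"] G[of "b # Z"] G[of "(a + b) # Z"] Z by simp
      qed
      have smaller: "size (B - {#z#}) < n" if "z \<in># B" for z
        using size_Suc_Diff1[OF that] sB by simp
      \<comment> \<open>Each of the four groups of terms is symmetric in v and w: the first and the third by
          right-symmetry, the last by exchanging z and y.\<close>
      have expand: "list_brace (w # v # Y) x =
          ((G B \<star> v) \<star> w - G B \<star> (v \<star> w))
          - ((\<Sum>z\<in>#B. G (add_mset (z \<star> v) (B - {#z#})) \<star> w)
             + (\<Sum>z\<in>#B. G (add_mset (z \<star> w) (B - {#z#})) \<star> v))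
          + (\<Sum>z\<in>#B. G (add_mset (z \<star> (v \<star> w) + (z \<star> w) \<star> v) (B - {#z#})))
          + (\<Sum>z\<in>#B. \<Sum>y\<in>#B - {#z#}. G (add_mset (y \<star> v) (add_mset (z \<star> w) (B - {#z#} - {#y#}))))"
        for v w
      proof -
        have "list_brace (w # v # Y) x = G (add_mset v B) \<star> w - G (add_mset (v \<star> w) B)
            - (\<Sum>z\<in>#B. G (add_mset (z \<star> w) (add_mset v B - {#z#})))"
          using rec[of "v # Y" w] len by (simp add: B_def algebra_simps)
        also have "(\<Sum>z\<in>#B. G (add_mset (z \<star> w) (add_mset v B - {#z#}))) =
            (\<Sum>z\<in>#B. G (add_mset v (add_mset (z \<star> w) (B - {#z#}))))"
          by (intro arg_cong[where f = sum_mset] image_mset_cong)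
            (simp add: add_mset_diff_single add_mset_commute)
        also have "\<dots> = (\<Sum>z\<in>#B. G (add_mset (z \<star> w) (B - {#z#})) \<star> v
              - G (add_mset ((z \<star> w) \<star> v) (B - {#z#}))
              - (\<Sum>y\<in>#B - {#z#}. G (add_mset (y \<star> v) (add_mset (z \<star> w) (B - {#z#} - {#y#})))))"
        proof (intro arg_cong[where f = sum_mset] image_mset_cong)
          fix z assume z: "z \<in># B"
          then have "size (add_mset (z \<star> w) (B - {#z#})) < n"
            using size_Suc_Diff1[OF z] sB by simp
          then have "G (add_mset v (add_mset (z \<star> w) (B - {#z#}))) =
              G (add_mset (z \<star> w) (B - {#z#})) \<star> v - G (add_mset ((z \<star> w) \<star> v) (B - {#z#}))
              - (\<Sum>y\<in>#B - {#z#}. G (add_mset (y \<star> v) (add_mset (z \<star> w) (B - {#z#}) - {#y#})))"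
            by (subst Grec) (auto simp: algebra_simps)
          moreover have "(\<Sum>y\<in>#B - {#z#}. G (add_mset (y \<star> v) (add_mset (z \<star> w) (B - {#z#}) - {#y#}))) =
              (\<Sum>y\<in>#B - {#z#}. G (add_mset (y \<star> v) (add_mset (z \<star> w) (B - {#z#} - {#y#}))))"
            by (intro arg_cong[where f = sum_mset] image_mset_cong) (simp add: add_mset_diff_single)
          ultimately show "G (add_mset v (add_mset (z \<star> w) (B - {#z#}))) =
              G (add_mset (z \<star> w) (B - {#z#})) \<star> v - G (add_mset ((z \<star> w) \<star> v) (B - {#z#}))
              - (\<Sum>y\<in>#B - {#z#}. G (add_mset (y \<star> v) (add_mset (z \<star> w) (B - {#z#} - {#y#}))))"
            by simp
        qed
        also have "G (add_mset v B) = G B \<star> v - (\<Sum>z\<in>#B. G (add_mset (z \<star> v) (B - {#z#})))"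
          by (rule Grec[OF sB])
        also have "G (add_mset (v \<star> w) B) =
            G B \<star> (v \<star> w) - (\<Sum>z\<in>#B. G (add_mset (z \<star> (v \<star> w)) (B - {#z#})))"
          by (rule Grec[OF sB])
        finally have "list_brace (w # v # Y) x = (G B \<star> v - (\<Sum>z\<in>#B. G (add_mset (z \<star> v) (B - {#z#})))) \<star> w -
  (G B \<star> (v \<star> w) - (\<Sum>z\<in>#B. G (add_mset (z \<star> (v \<star> w)) (B - {#z#})))) -
  (\<Sum>z\<in>#B. G (add_mset (z \<star> w) (B - {#z#})) \<star> v
              - G (add_mset ((z \<star> w) \<star> v) (B - {#z#}))
              - (\<Sum>y\<in>#B - {#z#}. G (add_mset (y \<star> v) (add_mset (z \<star> w) (B - {#z#} - {#y#})))))" .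
        moreover have "(\<Sum>z\<in>#B. G (add_mset (z \<star> (v \<star> w) + (z \<star> w) \<star> v) (B - {#z#}))) =
            (\<Sum>z\<in>#B. G (add_mset (z \<star> (v \<star> w)) (B - {#z#}))) +
            (\<Sum>z\<in>#B. G (add_mset ((z \<star> w) \<star> v) (B - {#z#})))"
          unfolding sum_mset.distrib[symmetric]
          by (intro arg_cong[where f = sum_mset] image_mset_cong Gadd smaller)
        ultimately show ?thesis
          by (simp add: diff_mul sum_mset_mul sum_mset_subtractf sum_mset.distrib algebra_simps)
      qed
      have "z \<star> (v \<star> w) + (z \<star> w) \<star> v = z \<star> (w \<star> v) + (z \<star> v) \<star> w" for z
        using right_symmetric[of z w v] by (simp add: algebra_simps)
      moreover have "(\<Sum>z\<in>#B. \<Sum>y\<in>#B - {#z#}.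
            G (add_mset (y \<star> v) (add_mset (z \<star> w) (B - {#z#} - {#y#})))) =
          (\<Sum>z\<in>#B. \<Sum>y\<in>#B - {#z#}. G (add_mset (y \<star> w) (add_mset (z \<star> v) (B - {#z#} - {#y#}))))"
        by (subst sum_mset_pairs_swap) (simp add: diff_right_commute add_mset_commute)
      ultimately show ?thesis
        unfolding expand[of w v] expand[of v w]
        using right_symmetric[of "G B" v w] by (simp add: add.commute)
    qed
    show ?case
    proof (intro allI impI)
      fix Z Z' :: "'a list"
      assume len: "length Z \<le> Suc n" and eq: "mset Z = mset Z'"
      show "list_brace Z x = list_brace Z' x"
      proof (cases Z)
        case Nil
        then show ?thesis using eq by simp
      next
        case (Cons w Y)
        then obtain w' Y' where Z': "Z' = w' # Y'" using eq by (cases Z') auto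
        have lY: "length Y \<le> n" and lY': "length Y' \<le> n"
          using len Cons Z' mset_eq_length[OF eq] by auto
        show ?thesis
        proof (cases "w = w'")
          case True
          then show ?thesis using eq Cons Z' cons[OF lY] by simp
        next
          case False
          define rest where "rest = remove1 w' Y"
          have w': "w' \<in> set Y" using eq Cons Z' False
            by (metis in_multiset_in_set insert_noteq_member mset.simps(2))
          have Y: "mset Y = mset (w' # rest)" using w' by (simp add: rest_def)
          have Y': "mset Y' = mset (w # rest)" using eq Cons Z' Y by (simp add: add_mset_commute)
          have lrest: "Suc (length rest) \<le> n" using mset_eq_length[OF Y] lY by simp
          have "list_brace (w # Y) x = list_brace (w # w' # rest) x" by (rule cons[OF lY Y])
          also have "\<dots> = list_brace (w' # w # rest) x" by (rule swap[OF lrest])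
          also have "\<dots> = list_brace (w' # Y') x" by (rule cons[OF lY' Y', symmetric])
          finally show ?thesis using Cons Z' by simp
        qed
      qed
    qed
  qed simp
  then show ?thesis using assms by blast
qed

end

section \<open>Differential monomials\<close>

text \<open>
  Adjacent transpositions generate all permutations.
\<close>

lemma invariant_under_permutation:
  assumes "\<And>xs a b ys. mset (xs @ a # b # ys) = mset l \<Longrightarrow> F (xs @ a # b # ys) = F (xs @ b # a # ys)"
    and "mset l = mset l'"
  shows "F l = F l'"
  using assms
proof (induction l arbitrary: F l')
  case (Cons c l)
  have "c \<in> set l'" using Cons.prems(2) by (metis list.set_intros(1) mset_eq_setD)
  then obtain xs ys where l': "l' = xs @ c # ys" by (meson split_list)
  have bubble: "F (us @ c # vs) = F (c # us @ vs)" if "mset (us @ c # vs) = mset (c # l)" for us vs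
    using that
  proof (induction us arbitrary: vs rule: rev_induct)
    case (snoc u us)
    have "F (us @ u # c # vs) = F (us @ c # u # vs)"
      using snoc.prems by (intro Cons.prems(1)) simp
    also have "\<dots> = F (c # us @ u # vs)" using snoc.prems by (intro snoc.IH) simp
    finally show ?case by simp
  qed simp
  have "F (c # l) = F (c # xs @ ys)"
  proof (rule Cons.IH[where F = "\<lambda>l. F (c # l)"])
    fix us a b vs assume "mset (us @ a # b # vs) = mset l"
    then show "F (c # us @ a # b # vs) = F (c # us @ b # a # vs)"
      using Cons.prems(1)[of "c # us" a b vs] by simp
  next
    show "mset l = mset (xs @ ys)" using Cons.prems(2) l' by simp
  qed
  then show ?case using bubble[of xs ys] Cons.prems(2) l' by simp
qed simp

lemma sum_mset_sum_mset: "(\<Sum>p\<in>#\<Sum>\<^sub># M. f p) = (\<Sum>m\<in>#M. \<Sum>p\<in>#m. f p)"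
  by (induction M) simp_all

text \<open>
  Counting a factor \<open>x\<^sup>(\<^sup>n\<^sup>)\<close> with weight \<open>n - 1\<close>, these are the monomials of weight \<open>-1\<close>, the only ones
  which occur in images of nonassociative words.
\<close>

definition admissible :: "('b \<times> nat) multiset \<Rightarrow> bool" where
  "admissible m \<longleftrightarrow> size m = Suc (\<Sum>p\<in>#m. snd p)"

text \<open>
  One summand of the derivative of a monomial: the factor \<open>p\<close> is replaced by its derivative.
\<close>

definition raise :: "('b \<times> nat) multiset \<Rightarrow> 'b \<times> nat \<Rightarrow> ('b \<times> nat) multiset" where
  "raise k p = add_mset (fst p, Suc (snd p)) (k - {#p#})"

lemma raise_add: "p \<in># k \<Longrightarrow> raise (k + l) p = raise k p + l"
  by (auto simp: raise_def dest!: multi_member_split)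

lemma admissible_raise:
  assumes "admissible k" "admissible l" "p \<in># k"
  shows "admissible (raise k p + l)"
proof -
  obtain k' where "k = add_mset p k'" using multi_member_split[OF assms(3)] by blast
  then show ?thesis using assms by (simp add: admissible_def raise_def)
qed

context novikov_product
begin

text \<open>
  The choice of the list is immaterial by \<open>list_brace_cong\<close>.
\<close>

definition brace :: "'a multiset \<Rightarrow> 'a \<Rightarrow> 'a" where
  "brace M x = list_brace (SOME Z. mset Z = M) x"

lemma brace_mset: "brace (mset Z) x = list_brace Z x"
  unfolding brace_def by (rule list_brace_cong, rule someI) (rule refl)

lemma brace_empty [simp]: "brace {#} x = x"
  using brace_mset[of "[]"] by simp

lemma brace_add_mset:
  "brace (add_mset w M) x = brace M x \<star> w - (\<Sum>z\<in>#M. brace (add_mset (z \<star> w) (M - {#z#})) x)"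
proof -
  obtain Z where Z: "M = mset Z" using ex_mset by metis
  have "sum_list (map f Z) = (\<Sum>z\<in>#M. f z)" for f :: "'a \<Rightarrow> 'a"
    unfolding Z by (metis mset_map sum_mset_sum_list)
  moreover have "list_brace ((z \<star> w) # remove1 z Z) x = brace (add_mset (z \<star> w) (M - {#z#})) x" for z
    using brace_mset[of "(z \<star> w) # remove1 z Z" x] Z by simp
  ultimately show ?thesis
    using brace_mset[of "w # Z" x] brace_mset[of Z x] Z list_brace.simps(2)[of w Z x] by simp
qed

lemma brace_mul:
  "brace M x \<star> w = brace (add_mset w M) x + (\<Sum>z\<in>#M. brace (add_mset (z \<star> w) (M - {#z#})) x)"
  by (simp add: brace_add_mset[of w M])

lemma brace_add: "brace (add_mset (u + v) M) x = brace (add_mset u M) x + brace (add_mset v M) x"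
proof -
  obtain Z where Z: "M = mset Z" using ex_mset by metis
  have "brace (add_mset w M) x = list_brace (w # Z) x" for w
    using brace_mset[of "w # Z" x] unfolding Z mset.simps .
  then show ?thesis by (simp only: list_brace_add)
qed

lemma brace_zero: "brace (add_mset 0 M) x = 0"
  using brace_add[of 0 0 M x] by simp

lemma brace_sum_mset: "brace (add_mset (\<Sum>p\<in>#P. f p) M) x = (\<Sum>p\<in>#P. brace (add_mset (f p) M) x)"
  by (induction P) (simp_all add: brace_zero brace_add)

text \<open>
  The endomorphisms that commute with all left multiplications. Left multiplications belong to them
  by left-commutativity; the typical case in the model is multiplication by an element of weight \<open>0\<close>.
\<close>

definition mul_linear :: "('a \<Rightarrow> 'a) \<Rightarrow> bool" where
  "mul_linear T \<longleftrightarrow> (\<forall>u v. T (u + v) = T u + T v) \<and> (\<forall>a u. T (a \<star> u) = a \<star> T u)"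

lemma mul_linear_diff: "mul_linear T \<Longrightarrow> T (u - v) = T u - T v"
  unfolding mul_linear_def by (metis add_diff_cancel diff_add_cancel)

lemma mul_linear_zero: "mul_linear T \<Longrightarrow> T 0 = 0"
  using mul_linear_diff[of T 0 0] by simp

lemma mul_linear_sum_mset: "mul_linear T \<Longrightarrow> T (\<Sum>p\<in>#P. f p) = (\<Sum>p\<in>#P. T (f p))"
  by (induction P) (simp_all add: mul_linear_zero, simp add: mul_linear_def)

text \<open>
  In the recursion for the brace the distinguished argument \<open>T u\<close> occurs only as a right factor, so
  \<open>T\<close> can be pulled out by induction. Taken for left multiplications, this says that
  \<open>u \<mapsto> x{u,M}\<close> is again \<open>mul_linear\<close>; taken for such a map, it says that any two of these maps
  commute.
\<close>

lemma brace_mul_linear: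
  assumes T: "mul_linear T"
  shows "brace (add_mset (T u) M) x = T (brace (add_mset u M) x)"
proof (induction "size M" arbitrary: u M)
  case 0
  then have "M = {#}" by simp
  then show ?case
    using T brace_add_mset[of _ "{#}" x] by (simp add: mul_linear_def)
next
  case (Suc n)
  have "brace (add_mset (z \<star> T u) (M - {#z#})) x = T (brace (add_mset (z \<star> u) (M - {#z#})) x)"
    if "z \<in># M" for z
  proof -
    have "n = size (M - {#z#})" using Suc(2) size_Suc_Diff1[OF that] by simp
    from Suc(1)[OF this, of "z \<star> u"] show ?thesis using T by (simp add: mul_linear_def)
  qed
  then have "(\<Sum>z\<in>#M. brace (add_mset (z \<star> T u) (M - {#z#})) x) =
      (\<Sum>z\<in>#M. T (brace (add_mset (z \<star> u) (M - {#z#})) x))"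
    by (intro arg_cong[where f = sum_mset] image_mset_cong) simp
  moreover have "brace M x \<star> T u = T (brace M x \<star> u)" using T by (simp add: mul_linear_def)
  ultimately show ?case
    by (simp add: brace_add_mset[of "T u"] brace_add_mset[of u] mul_linear_diff[OF T]
        mul_linear_sum_mset[OF T])
qed

lemma mul_linear_brace: "mul_linear (\<lambda>u. brace (add_mset u M) x)"
proof -
  have "mul_linear ((\<star>) a)" for a
    by (simp add: mul_linear_def distrib_left left_commutative)
  from brace_mul_linear[OF this] show ?thesis
    unfolding mul_linear_def by (simp add: brace_add)
qed

text \<open>
  Evaluates the monomial with derived factors \<open>hs\<close> and underived factors \<open>zs\<close> as a nested brace:
  \<open>x\<^sup>(\<^sup>n\<^sup>)\<close> consumes \<open>n - 1\<close> letters of \<open>zs\<close> and takes the value of the remaining blocks as its last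
  argument. Only lists \<open>zs\<close> with one letter more than the blocks consume are of interest.
\<close>

fun eval_blocks :: "('a \<times> nat) list \<Rightarrow> 'a list \<Rightarrow> 'a" where
  "eval_blocks [] zs = hd zs"
| "eval_blocks ((x, n) # hs) zs =
    brace (add_mset (eval_blocks hs (drop (n - 1) zs)) (mset (take (n - 1) zs))) x"

definition arity :: "('a \<times> nat) list \<Rightarrow> nat" where
  "arity hs = (\<Sum>p\<leftarrow>hs. snd p - 1)"

lemma arity_simps [simp]: "arity [] = 0" "arity ((x, n) # hs) = n - 1 + arity hs"
  "arity (hs @ hs') = arity hs + arity hs'"
  by (simp_all add: arity_def)

lemma arity_cong: "mset hs = mset hs' \<Longrightarrow> arity hs = arity hs'"
  unfolding arity_def sum_mset_sum_list[symmetric] mset_map by simp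

lemma mul_linear_eval_blocks:
  assumes "length Y = arity hs"
  shows "mul_linear (\<lambda>u. eval_blocks hs (Y @ [u]))"
  using assms
proof (induction hs Y rule: eval_blocks.induct)
  case (2 x n hs Y)
  define T where "T u = eval_blocks hs (drop (n - 1) Y @ [u])" for u
  have "mul_linear T" unfolding T_def using 2 by simp
  then have "mul_linear (\<lambda>u. brace (add_mset (T u) (mset (take (n - 1) Y))) x)"
    using mul_linear_brace[of "mset (take (n - 1) Y)" x] by (simp add: mul_linear_def)
  then show ?case using 2(2) by (simp add: T_def)
qed (simp add: mul_linear_def)

lemma eval_blocks_append:
  assumes "length Y = arity hs"
  shows "eval_blocks hs (Y @ [eval_blocks hs' zs']) = eval_blocks (hs @ hs') (Y @ zs')"
  using assms by (induction hs Y rule: eval_blocks.induct) simp_all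

text \<open>
  Two adjacent letters either are consumed by the same block, where the brace is symmetric, or both
  go to later blocks, or the border between the first block and the rest runs between them.
\<close>

lemma eval_blocks_swap_letters:
  assumes "length (xs @ a # b # ys) = Suc (arity hs)"
  shows "eval_blocks hs (xs @ a # b # ys) = eval_blocks hs (xs @ b # a # ys)"
  using assms
proof (induction hs arbitrary: xs a b ys)
  case (Cons p hs)
  obtain x n where p: "p = (x, n)" by (cases p)
  define k where "k = n - Suc 0"
  consider "length xs + 2 \<le> k" | "k \<le> length xs" | "k = Suc (length xs)" by linarith
  then show ?case
  proof cases
    case 1
    then obtain j where k: "k = Suc (Suc (length xs + j))" by (auto simp: le_iff_add)
    show ?thesis by (simp add: p k_def[symmetric] add_mset_commute) (simp add: k add_mset_commute)
  next
    case 2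
    have "eval_blocks hs (drop k xs @ a # b # ys) = eval_blocks hs (drop k xs @ b # a # ys)"
      using Cons.prems 2 by (intro Cons.IH) (simp add: p k_def)
    then show ?thesis using 2 by (simp add: p k_def[symmetric])
  next
    case 3
    \<comment> \<open>The blocks after the border form a map S that commutes with the brace before it, so the
    letters on the two sides of the border can be exchanged inside that brace.\<close>
    define S where "S u = eval_blocks hs (ys @ [u])" for u
    have len: "Suc (length ys) = Suc (arity hs)" using Cons.prems 3 by (simp add: p k_def[symmetric])
    have "eval_blocks hs (c # ys) = S c" for c
      unfolding S_def
    proof (rule invariant_under_permutation)
      fix us c' d vs assume "mset (us @ c' # d # vs) = mset (c # ys)"
      then have "length (us @ c' # d # vs) = length (c # ys)" by (rule mset_eq_length)
      then show "eval_blocks hs (us @ c' # d # vs) = eval_blocks hs (us @ d # c' # vs)"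
        using len by (intro Cons.IH) simp
    qed simp
    moreover have "mul_linear S" unfolding S_def using len by (intro mul_linear_eval_blocks) simp
    then have "brace (add_mset c (add_mset (S d) M)) x = S (brace (add_mset c (add_mset d M)) x)"
      for c d M
      using brace_mul_linear[of S d "add_mset c M" x] by (simp add: add_mset_commute)
    ultimately show ?thesis using 3
      by (simp add: p k_def[symmetric]) (simp add: add_mset_commute)
  qed
qed simp

lemma eval_blocks_letters_cong:
  assumes "length zs = Suc (arity hs)" "mset zs = mset zs'"
  shows "eval_blocks hs zs = eval_blocks hs zs'"
proof (rule invariant_under_permutation[OF _ assms(2)])
  fix xs a b ys assume "mset (xs @ a # b # ys) = mset zs"
  from mset_eq_length[OF this] show "eval_blocks hs (xs @ a # b # ys) = eval_blocks hs (xs @ b # a # ys)"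
    using assms(1) by (intro eval_blocks_swap_letters) simp
qed

text \<open>
  The operators of two adjacent blocks commute; exchanging them permutes the letters that they
  consume, which does not matter by \<open>eval_blocks_letters_cong\<close>.
\<close>

lemma eval_blocks_swap_heads:
  assumes "length zs = Suc (arity (ps @ p # q # hs))"
  shows "eval_blocks (ps @ p # q # hs) zs = eval_blocks (ps @ q # p # hs) zs"
  using assms
proof (induction ps arbitrary: zs)
  case Nil
  obtain x n y m where pq: "p = (x, n)" "q = (y, m)" by (cases p, cases q)
  define i j where "i = n - 1" and "j = m - 1"
  define A where "A = take i zs"
  define B where "B = take j (drop i zs)"
  define C where "C = drop (i + j) zs"
  have zs: "zs = A @ B @ C"
    unfolding A_def B_def C_def by (metis append_take_drop_id drop_drop add.commute)
  have len: "length A = i" "length B = j"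
    using Nil by (auto simp: A_def B_def pq i_def j_def)
  have "eval_blocks (p # q # hs) zs =
      brace (add_mset (brace (add_mset (eval_blocks hs C) (mset B)) y) (mset A)) x"
    using len by (simp add: pq zs i_def j_def)
  also have "\<dots> = brace (add_mset (brace (add_mset (eval_blocks hs C) (mset A)) x) (mset B)) y"
    using brace_mul_linear[OF mul_linear_brace] by simp
  also have "\<dots> = eval_blocks (q # p # hs) (B @ A @ C)"
    using len by (simp add: pq i_def j_def)
  also have "\<dots> = eval_blocks (q # p # hs) zs"
    using Nil by (intro eval_blocks_letters_cong) (auto simp: zs pq)
  finally show ?case by simp
next
  case (Cons r ps)
  obtain x n where r: "r = (x, n)" by (cases r)
  show ?case using Cons.prems Cons.IH[of "drop (n - 1) zs"] by (simp add: r)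
qed

lemma eval_blocks_cong:
  assumes "length zs = Suc (arity hs)" "mset zs = mset zs'" "mset hs = mset hs'"
  shows "eval_blocks hs zs = eval_blocks hs' zs'"
proof -
  have "eval_blocks hs zs = eval_blocks hs' zs"
  proof (rule invariant_under_permutation[OF _ assms(3)])
    fix ps p q qs assume "mset (ps @ p # q # qs) = mset hs"
    from arity_cong[OF this] show "eval_blocks (ps @ p # q # qs) zs = eval_blocks (ps @ q # p # qs) zs"
      using assms(1) by (intro eval_blocks_swap_heads) simp
  qed
  also have "\<dots> = eval_blocks hs' zs'"
    using assms arity_cong[OF assms(3)] by (intro eval_blocks_letters_cong) simp_all
  finally show ?thesis .
qed

definition blocks_of :: "('a \<times> nat) list \<Rightarrow> 'a list \<Rightarrow> ('a \<times> nat) multiset" where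
  "blocks_of hs zs = mset hs + image_mset (\<lambda>z. (z, 0)) (mset zs)"

text \<open>
  Well-defined on admissible monomials, see \<open>eval_monomial_blocks_of\<close>; other monomials get an
  arbitrary value.
\<close>

definition eval_monomial :: "('a \<times> nat) multiset \<Rightarrow> 'a" where
  "eval_monomial m = (SOME v. \<exists>hs zs. m = blocks_of hs zs \<and> (\<forall>p\<in>set hs. 0 < snd p) \<and> v = eval_blocks hs zs)"

lemma blocks_of_exists: "\<exists>hs zs. m = blocks_of hs zs \<and> (\<forall>p\<in>set hs. 0 < snd p)"
proof -
  obtain hs where hs: "mset hs = filter_mset (\<lambda>p. 0 < snd p) m" using ex_mset by blast
  obtain zs where zs: "mset zs = image_mset fst (filter_mset (\<lambda>p. \<not> 0 < snd p) m)"
    using ex_mset by blast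
  have "image_mset (\<lambda>z. (z, 0)) (mset zs) = image_mset (\<lambda>p. p) (filter_mset (\<lambda>p. \<not> 0 < snd p) m)"
    unfolding zs multiset.map_comp comp_def by (rule image_mset_cong) auto
  then have "m = blocks_of hs zs"
    unfolding blocks_of_def hs using multiset_partition[of m "\<lambda>p. 0 < snd p"] by simp
  moreover have "\<forall>p\<in>set hs. 0 < snd p"
    unfolding set_mset_mset[symmetric] hs by simp
  ultimately show ?thesis by blast
qed

lemma blocks_of_eq_iff:
  assumes "\<forall>p\<in>set hs. 0 < snd p" "\<forall>p\<in>set hs'. 0 < snd p"
  shows "blocks_of hs zs = blocks_of hs' zs' \<longleftrightarrow> mset hs = mset hs' \<and> mset zs = mset zs'"
proof
  assume eq: "blocks_of hs zs = blocks_of hs' zs'"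
  have *: "filter_mset (\<lambda>p. 0 < snd p) (blocks_of hs zs) = mset hs \<and>
      image_mset fst (filter_mset (\<lambda>p. snd p = 0) (blocks_of hs zs)) = mset zs"
    if "\<forall>p\<in>set hs. 0 < snd p" for hs zs
  proof -
    have "filter_mset (\<lambda>p. 0 < snd p) (mset hs) = mset hs"
      "filter_mset (\<lambda>p. snd p = 0) (mset hs) = {#}"
      using that by (induction hs) auto
    then show ?thesis
      by (simp add: blocks_of_def filter_mset_image_mset multiset.map_comp comp_def)
  qed
  show "mset hs = mset hs' \<and> mset zs = mset zs'"
    using *[OF assms(1), of zs] *[OF assms(2), of zs'] eq by simp
qed (simp add: blocks_of_def)

lemma admissible_blocks_of:
  assumes "\<forall>p\<in>set hs. 0 < snd p"
  shows "admissible (blocks_of hs zs) \<longleftrightarrow> length zs = Suc (arity hs)"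
proof -
  have "(\<Sum>p\<leftarrow>hs. snd p) = length hs + arity hs"
    using assms by (induction hs) (auto simp: arity_def)
  moreover have "(\<Sum>p\<in>#mset hs. snd p) = (\<Sum>p\<leftarrow>hs. snd p)"
    unfolding sum_mset_sum_list[symmetric] mset_map ..
  ultimately show ?thesis
    by (simp add: admissible_def blocks_of_def multiset.map_comp comp_def)
qed

lemma eval_monomial_blocks_of:
  assumes "\<forall>p\<in>set hs. 0 < snd p" "admissible (blocks_of hs zs)"
  shows "eval_monomial (blocks_of hs zs) = eval_blocks hs zs"
  unfolding eval_monomial_def
proof (rule some_equality)
  fix v assume "\<exists>hs' zs'. blocks_of hs zs = blocks_of hs' zs' \<and> (\<forall>p\<in>set hs'. 0 < snd p) \<and> v = eval_blocks hs' zs'"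
  then obtain hs' zs' where *: "blocks_of hs zs = blocks_of hs' zs'" "\<forall>p\<in>set hs'. 0 < snd p" "v = eval_blocks hs' zs'"
    by blast
  then have "mset hs = mset hs'" "mset zs = mset zs'" using blocks_of_eq_iff[OF assms(1) *(2)] by auto
  then show "v = eval_blocks hs zs"
    using assms admissible_blocks_of[OF assms(1)] *(3) eval_blocks_cong[of zs hs zs' hs'] by simp
qed (use assms in blast)

lemma eval_monomial_single [simp]: "eval_monomial {#(x, 0)#} = x"
  using eval_monomial_blocks_of[of "[]" "[x]"] admissible_blocks_of[of "[]" "[x]"]
  by (simp add: blocks_of_def)

text \<open>
  A brace of values of monomials is the value of the product. One argument at a time is reduced to a
  letter \<open>z\<close>: it has the form \<open>S z\<close> with \<open>S\<close> a \<open>mul_linear\<close> map, and \<open>S\<close> can be moved to the next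
  argument. When a single argument that is no letter is left, the brace is by definition a nested
  brace in block form.
\<close>

lemma brace_eval_monomial:
  assumes "\<forall>m\<in>set ms. admissible m" "ms \<noteq> []"
  shows "brace (mset Z + image_mset eval_monomial (mset ms)) x =
    eval_monomial (add_mset (x, length Z + length ms) (blocks_of [] Z + \<Sum>\<^sub># (mset ms)))"
  using assms
proof (induction "length ms" arbitrary: ms Z)
  case (Suc n)
  obtain m ms' where ms: "ms = m # ms'" using Suc(2) by (cases ms) auto
  obtain hs zs where m: "m = blocks_of hs zs" "\<forall>p\<in>set hs. 0 < snd p" using blocks_of_exists by metis
  have adm: "admissible (blocks_of hs zs)" using Suc.prems ms m by simp
  have len: "length zs = Suc (arity hs)" using admissible_blocks_of[OF m(2)] adm by simp
  have Em: "eval_monomial m = eval_blocks hs zs" using eval_monomial_blocks_of m adm by simp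
  show ?case
  proof (cases ms')
    case Nil
    define h where "h = ((x, Suc (length Z)) # hs)"
    have "\<forall>p\<in>set h. 0 < snd p" using m(2) by (simp add: h_def)
    moreover from this have "admissible (blocks_of h (Z @ zs))"
      using len by (simp add: admissible_blocks_of) (simp add: h_def)
    ultimately have "eval_monomial (blocks_of h (Z @ zs)) = eval_blocks h (Z @ zs)"
      by (rule eval_monomial_blocks_of)
    then have "eval_monomial (blocks_of h (Z @ zs)) = brace (add_mset (eval_monomial m) (mset Z)) x"
      by (simp add: h_def Em)
    then show ?thesis by (simp add: h_def ms Nil m(1) blocks_of_def add_ac)
  next
    case (Cons m' ms'')
    obtain Y z where zs: "zs = Y @ [z]" using len by (cases zs rule: rev_cases) auto
    obtain hs' zs' where m': "m' = blocks_of hs' zs'" "\<forall>p\<in>set hs'. 0 < snd p"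
      using blocks_of_exists by metis
    have adm': "admissible (blocks_of hs' zs')" using Suc.prems ms Cons m' by simp
    have len': "length zs' = Suc (arity hs')" using admissible_blocks_of[OF m'(2)] adm' by simp
    have Em': "eval_monomial m' = eval_blocks hs' zs'" using eval_monomial_blocks_of m' adm' by simp
    define S where "S u = eval_blocks hs (Y @ [u])" for u
    have S: "mul_linear S" unfolding S_def using len zs by (intro mul_linear_eval_blocks) simp
    \<comment> \<open>The product of all factors of m except z with m'.\<close>
    define r where "r = blocks_of (hs @ hs') (Y @ zs')"
    have pos: "\<forall>p\<in>set (hs @ hs'). 0 < snd p" using m(2) m'(2) by auto
    have admr: "admissible r"
      unfolding r_def admissible_blocks_of[OF pos] using len len' zs by simp
    have Er: "eval_monomial r = S (eval_monomial m')"
      unfolding r_def eval_monomial_blocks_of[OF pos admr[unfolded r_def]] S_def Em'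
      using len zs by (simp add: eval_blocks_append)
    define R where "R = mset Z + image_mset eval_monomial (mset ms'')"
    have "mset Z + image_mset eval_monomial (mset ms) =
        add_mset (S z) (add_mset (eval_monomial m') R)"
      by (simp add: ms Cons Em zs S_def R_def)
    then have "brace (mset Z + image_mset eval_monomial (mset ms)) x =
        brace (add_mset (S z) (add_mset (eval_monomial m') R)) x" by simp
    also have "\<dots> = S (brace (add_mset z (add_mset (eval_monomial m') R)) x)"
      by (rule brace_mul_linear[OF S])
    also have "\<dots> = brace (add_mset (eval_monomial r) (add_mset z R)) x"
      unfolding Er brace_mul_linear[OF S] by (simp add: add_mset_commute)
    also have "add_mset (eval_monomial r) (add_mset z R) =
        mset (z # Z) + image_mset eval_monomial (mset (r # ms''))"
      by (simp add: R_def)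
    also have "brace \<dots> x = eval_monomial (add_mset (x, length (z # Z) + length (r # ms''))
        (blocks_of [] (z # Z) + \<Sum>\<^sub># (mset (r # ms''))))"
      using Suc.prems Suc.hyps(2) admr by (intro Suc.hyps(1)) (simp_all add: ms Cons)
    also have "length (z # Z) + length (r # ms'') = length Z + length ms" by (simp add: ms Cons)
    also have "blocks_of [] (z # Z) + \<Sum>\<^sub># (mset (r # ms'')) = blocks_of [] Z + \<Sum>\<^sub># (mset ms)"
      by (simp add: ms Cons m(1) m'(1) r_def zs blocks_of_def)
    finally show ?thesis .
  qed
qed simp

corollary brace_image_eval_monomial:
  assumes "\<forall>m\<in>#Ms. admissible m"
  shows "brace (image_mset eval_monomial Ms) x = eval_monomial (add_mset (x, size Ms) (\<Sum>\<^sub># Ms))"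
proof (cases "Ms = {#}")
  case False
  obtain ms where "Ms = mset ms" using ex_mset by metis
  then show ?thesis using brace_eval_monomial[of ms "[]" x] assms False by (simp add: blocks_of_def)
qed simp

text \<open>
  The root and the subtrees of a nested brace: choose the derived factor \<open>x\<^sup>(\<^sup>n\<^sup>)\<close> of the first block,
  \<open>n - 1\<close> letters and the remaining factors.
\<close>

lemma admissible_decompose:
  fixes k :: "('a \<times> nat) multiset"
  assumes "admissible k"
  obtains x Ms where "k = add_mset (x, size Ms) (\<Sum>\<^sub># Ms)" "\<forall>m\<in>#Ms. admissible m"
proof -
  obtain hs zs where k: "k = blocks_of hs zs" "\<forall>p\<in>set hs. 0 < snd p" using blocks_of_exists by metis
  have len: "length zs = Suc (arity hs)" using admissible_blocks_of[OF k(2)] assms k(1) by simp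
  show ?thesis
  proof (cases hs)
    case Nil
    then obtain z where "zs = [z]" using len by (auto simp: length_Suc_conv)
    then show ?thesis using that[of z "{#}"] by (simp add: k(1) Nil blocks_of_def)
  next
    case (Cons p hs')
    obtain x n where p: "p = (x, n)" by (cases p)
    define Z where "Z = take (n - 1) zs"
    define Y where "Y = drop (n - 1) zs"
    have n: "0 < n" using k(2) by (simp add: Cons p)
    have zs: "zs = Z @ Y" by (simp add: Z_def Y_def)
    have lZ: "length Z = n - 1" using len by (simp add: Z_def Cons p)
    define Ms where "Ms = add_mset (blocks_of hs' Y) (image_mset (\<lambda>z. {#(z, 0)#}) (mset Z))"
    have "admissible (blocks_of hs' Y)"
      using k(2) len by (subst admissible_blocks_of) (auto simp: Cons p Y_def)
    then have "\<forall>m\<in>#Ms. admissible m" by (auto simp: Ms_def admissible_def)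
    moreover have "\<Sum>\<^sub># (image_mset (\<lambda>z. {#(z, 0)#}) M) = image_mset (\<lambda>z. (z, 0)) M" for M :: "'a multiset"
      by (induction M) simp_all
    then have "k = add_mset (x, size Ms) (\<Sum>\<^sub># Ms)"
      using n lZ by (simp add: Ms_def k(1) Cons p zs blocks_of_def)
    ultimately show ?thesis using that by blast
  qed
qed

text \<open>
  In the model the right-hand side is the derivative of \<open>k\<close> times \<open>l\<close>. Write \<open>k\<close> as a brace with root
  \<open>x\<close> and arguments \<open>Ms\<close>. Multiplying a brace by \<open>v\<close> gives, by its recursion, the brace with the
  additional argument \<open>v\<close>, where the derivative hits \<open>x\<close>, and the braces with one argument multiplied
  by \<open>v\<close>, to which the induction hypothesis applies.
\<close>

theorem eval_monomial_mul:
  assumes "admissible k" "admissible l"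
  shows "eval_monomial k \<star> eval_monomial l = (\<Sum>p\<in>#k. eval_monomial (raise k p + l))"
  using assms(1)
proof (induction "size k" arbitrary: k rule: less_induct)
  case less
  obtain x Ms where k: "k = add_mset (x, size Ms) (\<Sum>\<^sub># Ms)" and Ms: "\<forall>m\<in>#Ms. admissible m"
    using admissible_decompose[OF less.prems] .
  define v where "v = eval_monomial l"
  have Ek: "eval_monomial k = brace (image_mset eval_monomial Ms) x"
    unfolding k using brace_image_eval_monomial[OF Ms] by simp
  have root: "brace (add_mset v (image_mset eval_monomial Ms)) x =
      eval_monomial (raise k (x, size Ms) + l)"
    using brace_image_eval_monomial[of "add_mset l Ms" x] Ms assms(2)
    by (simp add: v_def k raise_def add_ac)
  have child: "brace (add_mset (eval_monomial m \<star> v) (image_mset eval_monomial Ms - {#eval_monomial m#})) x =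
      (\<Sum>p\<in>#m. eval_monomial (raise k p + l))" if m: "m \<in># Ms" for m
  proof -
    define Ns where "Ns = Ms - {#m#}"
    have MsN: "Ms = add_mset m Ns" using m by (simp add: Ns_def)
    have "size m < size k" using k MsN by simp
    then have "eval_monomial m \<star> v = (\<Sum>p\<in>#m. eval_monomial (raise m p + l))"
      unfolding v_def using less.hyps Ms m by blast
    then have "brace (add_mset (eval_monomial m \<star> v) (image_mset eval_monomial Ms - {#eval_monomial m#})) x =
        (\<Sum>p\<in>#m. brace (add_mset (eval_monomial (raise m p + l)) (image_mset eval_monomial Ns)) x)"
      by (simp add: MsN brace_sum_mset)
    also have "\<dots> = (\<Sum>p\<in>#m. eval_monomial (raise k p + l))"
    proof (intro arg_cong[where f = sum_mset] image_mset_cong)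
      fix p assume p: "p \<in># m"
      have "admissible (raise m p + l)" using admissible_raise Ms m assms(2) p by blast
      then have "brace (add_mset (eval_monomial (raise m p + l)) (image_mset eval_monomial Ns)) x =
          eval_monomial (add_mset (x, size Ms) (raise m p + l + \<Sum>\<^sub># Ns))"
        using brace_image_eval_monomial[of "add_mset (raise m p + l) Ns" x] Ms MsN by simp
      also have "raise k p = add_mset (x, size Ms) (\<Sum>\<^sub># Ns) + raise m p"
        using raise_add[OF p, of "add_mset (x, size Ms) (\<Sum>\<^sub># Ns)"] k MsN by (simp add: add_ac)
      then have "add_mset (x, size Ms) (raise m p + l + \<Sum>\<^sub># Ns) = raise k p + l" by (simp add: add_ac)
      finally show "brace (add_mset (eval_monomial (raise m p + l)) (image_mset eval_monomial Ns)) x =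
          eval_monomial (raise k p + l)" .
    qed
    finally show ?thesis .
  qed
  have "eval_monomial k \<star> v = eval_monomial (raise k (x, size Ms) + l) +
      (\<Sum>m\<in>#Ms. \<Sum>p\<in>#m. eval_monomial (raise k p + l))"
    unfolding Ek brace_mul root multiset.map_comp comp_def
    by (intro arg_cong2[where f = "(+)"] refl arg_cong[where f = sum_mset] image_mset_cong child)
  also have "(\<Sum>m\<in>#Ms. \<Sum>p\<in>#m. eval_monomial (raise k p + l)) =
      (\<Sum>p\<in>#\<Sum>\<^sub># Ms. eval_monomial (raise k p + l))"
    by (rule sum_mset_sum_mset[symmetric])
  also have "eval_monomial (raise k (x, size Ms) + l) + \<dots> = (\<Sum>p\<in>#k. eval_monomial (raise k p + l))"
    by (simp add: k)
  finally show ?case unfolding v_def .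
qed

end

section \<open>Nonassociative algebras and their quotients\<close>

lemma poly_mapping_add_induct [case_names zero single add]:
  fixes f :: "'a \<Rightarrow>\<^sub>0 'b::comm_monoid_add"
  assumes "P 0" "\<And>k c. P (Poly_Mapping.single k c)" "\<And>f g. P f \<Longrightarrow> P g \<Longrightarrow> P (f + g)"
  shows "P f"
proof -
  have "f = (\<Sum>k\<in>Poly_Mapping.keys f. Poly_Mapping.single k (Poly_Mapping.lookup f k))"
    by (rule poly_mapping_eqI) (simp add: lookup_sum lookup_single when_def sum.delta in_keys_iff)
  moreover have "P (\<Sum>k\<in>S. Poly_Mapping.single k (Poly_Mapping.lookup f k))" for S
    by (induction S rule: infinite_finite_induct) (use assms in auto)
  ultimately show ?thesis by metis
qed

lemma lookup_map_scale [simp]: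
  fixes f :: "'a \<Rightarrow>\<^sub>0 'k::comm_ring_1"
  shows "Poly_Mapping.lookup (Poly_Mapping.map ((*) c) f) k = c * Poly_Mapping.lookup f k"
  by (simp add: map.rep_eq when_def)

lemma map_scale_add:
  fixes f g :: "'a \<Rightarrow>\<^sub>0 'k::comm_ring_1"
  shows "Poly_Mapping.map ((*) c) (f + g) = Poly_Mapping.map ((*) c) f + Poly_Mapping.map ((*) c) g"
  by (rule poly_mapping_eqI) (simp add: lookup_add algebra_simps)

lemma map_scale_zero [simp]: "Poly_Mapping.map ((*) c) 0 = (0 :: 'a \<Rightarrow>\<^sub>0 'k::comm_ring_1)"
  by (rule poly_mapping_eqI) simp

text \<open>
  These turn the facts of the locale for modules, which speak of a ring record of scalars, into facts
  about scalars of the type \<open>'k\<close>.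
\<close>

lemma ring_of_type_algebra_simps [simp]:
  "carrier (ring_of_type_algebra :: 'k::comm_ring_1 ring) = UNIV"
  "a \<oplus>\<^bsub>ring_of_type_algebra\<^esub> b = (a + b :: 'k)"
  "a \<otimes>\<^bsub>ring_of_type_algebra\<^esub> b = (a * b :: 'k)"
  "\<one>\<^bsub>ring_of_type_algebra\<^esub> = (1 :: 'k)"
  "\<zero>\<^bsub>ring_of_type_algebra\<^esub> = (0 :: 'k)"
  by (simp_all add: ring_of_type_algebra_def)

context nonassoc_algebra
begin

lemmas smult_add_left = smult_l_distr[simplified]
lemmas smult_add_right = smult_r_distr[simplified]
lemmas smult_smult = smult_assoc1[simplified]
lemmas smult_mem = smult_closed[simplified]
lemmas zero_smult = smult_l_null[simplified]

lemma zero_mult: "x \<in> carrier A \<Longrightarrow> \<zero>\<^bsub>A\<^esub> \<otimes>\<^bsub>A\<^esub> x = \<zero>\<^bsub>A\<^esub>"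
  using mult_smult_left[of "\<zero>\<^bsub>A\<^esub>" x 0] mult_closed[of "\<zero>\<^bsub>A\<^esub>" x] by (simp add: zero_smult)

lemma mult_zero: "x \<in> carrier A \<Longrightarrow> x \<otimes>\<^bsub>A\<^esub> \<zero>\<^bsub>A\<^esub> = \<zero>\<^bsub>A\<^esub>"
  using mult_smult_right[of x "\<zero>\<^bsub>A\<^esub>" 0] mult_closed[of x "\<zero>\<^bsub>A\<^esub>"] by (simp add: zero_smult)

lemma eval_word_closed:
  assumes "\<And>i. \<rho> i \<in> carrier A"
  shows "eval_word A \<rho> w \<in> carrier A"
  by (induction w) (simp_all add: assms mult_closed)

lemma eval_poly_superset:
  assumes "\<And>i. \<rho> i \<in> carrier A" "finite S" "Poly_Mapping.keys f \<subseteq> S"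
  shows "eval_poly A \<rho> f = (\<Oplus>\<^bsub>A\<^esub>w\<in>S. Poly_Mapping.lookup f w \<odot>\<^bsub>A\<^esub> eval_word A \<rho> w)"
  unfolding eval_poly_def
proof (rule add.finprod_mono_neutral_cong_left)
  show "Poly_Mapping.lookup f i \<odot>\<^bsub>A\<^esub> eval_word A \<rho> i = \<zero>\<^bsub>A\<^esub>"
    if "i \<in> S - Poly_Mapping.keys f" for i
    using that eval_word_closed[of \<rho>, OF assms(1)] by (simp add: in_keys_iff zero_smult)
qed (use assms eval_word_closed[of \<rho>] smult_mem in auto)

lemma eval_poly_closed:
  assumes "\<And>i. \<rho> i \<in> carrier A"
  shows "eval_poly A \<rho> f \<in> carrier A"
  unfolding eval_poly_def by (rule finsum_closed) (use assms eval_word_closed[of \<rho>] smult_mem in auto)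

lemma eval_poly_add:
  assumes "\<And>i. \<rho> i \<in> carrier A"
  shows "eval_poly A \<rho> (f + g) = eval_poly A \<rho> f \<oplus>\<^bsub>A\<^esub> eval_poly A \<rho> g"
proof -
  let ?S = "Poly_Mapping.keys f \<union> Poly_Mapping.keys g"
  have "eval_poly A \<rho> (f + g) = (\<Oplus>\<^bsub>A\<^esub>w\<in>?S. Poly_Mapping.lookup f w \<odot>\<^bsub>A\<^esub> eval_word A \<rho> w \<oplus>\<^bsub>A\<^esub>
      Poly_Mapping.lookup g w \<odot>\<^bsub>A\<^esub> eval_word A \<rho> w)"
    using eval_word_closed[of \<rho>, OF assms]
    by (simp add: eval_poly_superset[of \<rho>, OF assms _ keys_add] lookup_add smult_add_left)
  also have "\<dots> = (\<Oplus>\<^bsub>A\<^esub>w\<in>?S. Poly_Mapping.lookup f w \<odot>\<^bsub>A\<^esub> eval_word A \<rho> w) \<oplus>\<^bsub>A\<^esub>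
      (\<Oplus>\<^bsub>A\<^esub>w\<in>?S. Poly_Mapping.lookup g w \<odot>\<^bsub>A\<^esub> eval_word A \<rho> w)"
    using eval_word_closed[of \<rho>, OF assms] smult_mem by (intro finsum_addf) auto
  finally show ?thesis
    using eval_poly_superset[of \<rho>, OF assms, where S = ?S] by simp
qed

lemma eval_poly_single:
  assumes "\<And>i. \<rho> i \<in> carrier A"
  shows "eval_poly A \<rho> (Poly_Mapping.single w c) = c \<odot>\<^bsub>A\<^esub> eval_word A \<rho> w"
  using eval_word_closed[of \<rho>, OF assms, of w] smult_mem
  by (subst eval_poly_superset[of \<rho>, OF assms, where S = "{w}"]) (auto simp: finsum_insert)

lemma eval_poly_zero: "eval_poly A \<rho> 0 = \<zero>\<^bsub>A\<^esub>"
  by (simp add: eval_poly_def)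

lemma eval_poly_smult:
  assumes "\<And>i. \<rho> i \<in> carrier A"
  shows "eval_poly A \<rho> (Poly_Mapping.map ((*) c) f) = c \<odot>\<^bsub>A\<^esub> eval_poly A \<rho> f"
proof (induction f rule: poly_mapping_add_induct)
  case (add f g)
  then show ?case
    by (simp add: map_scale_add eval_poly_add assms smult_add_right eval_poly_closed)
qed (simp_all add: eval_poly_zero eval_poly_single assms smult_smult eval_word_closed smult_r_null)

end

lemma nonassoc_poly_mult_superset:
  assumes "finite S" "finite T" "Poly_Mapping.keys f \<subseteq> S" "Poly_Mapping.keys g \<subseteq> T"
  shows "nonassoc_poly_mult f g = (\<Sum>u\<in>S. \<Sum>v\<in>T.
    Poly_Mapping.single (Juxt u v) (Poly_Mapping.lookup f u * Poly_Mapping.lookup g v))"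
proof -
  have "nonassoc_poly_mult f g = (\<Sum>u\<in>Poly_Mapping.keys f. \<Sum>v\<in>T.
    Poly_Mapping.single (Juxt u v) (Poly_Mapping.lookup f u * Poly_Mapping.lookup g v))"
    unfolding nonassoc_poly_mult_def using assms
    by (intro sum.cong sum.mono_neutral_left) (auto simp: in_keys_iff)
  also have "\<dots> = (\<Sum>u\<in>S. \<Sum>v\<in>T.
    Poly_Mapping.single (Juxt u v) (Poly_Mapping.lookup f u * Poly_Mapping.lookup g v))"
    using assms by (intro sum.mono_neutral_left) (auto simp: in_keys_iff)
  finally show ?thesis .
qed

lemma nonassoc_poly_mult_single:
  "nonassoc_poly_mult (Poly_Mapping.single u a) (Poly_Mapping.single v b) =
    Poly_Mapping.single (Juxt u v) (a * b)"
  by (simp add: nonassoc_poly_mult_def)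

lemma nonassoc_poly_mult_add_left:
  "nonassoc_poly_mult (f + g) h = nonassoc_poly_mult f h + nonassoc_poly_mult g h"
proof -
  let ?S = "Poly_Mapping.keys f \<union> Poly_Mapping.keys g"
  note * = nonassoc_poly_mult_superset[where S = ?S and T = "Poly_Mapping.keys h"]
  show ?thesis
    by (subst (1 2 3) *) (auto simp: keys_add lookup_add distrib_right single_add sum.distrib)
qed

lemma nonassoc_poly_mult_add_right:
  "nonassoc_poly_mult h (f + g) = nonassoc_poly_mult h f + nonassoc_poly_mult h g"
proof -
  let ?S = "Poly_Mapping.keys f \<union> Poly_Mapping.keys g"
  note * = nonassoc_poly_mult_superset[where T = ?S and S = "Poly_Mapping.keys h"]
  show ?thesis
    by (subst (1 2 3) *) (auto simp: keys_add lookup_add distrib_left single_add sum.distrib)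
qed

lemma nonassoc_poly_mult_zero [simp]:
  "nonassoc_poly_mult 0 g = 0" "nonassoc_poly_mult f 0 = 0"
  by (simp_all add: nonassoc_poly_mult_def)

lemma nonassoc_poly_mult_scale:
  "nonassoc_poly_mult (Poly_Mapping.map ((*) c) f) g = Poly_Mapping.map ((*) c) (nonassoc_poly_mult f g)"
  "nonassoc_poly_mult f (Poly_Mapping.map ((*) c) g) = Poly_Mapping.map ((*) c) (nonassoc_poly_mult f g)"
proof -
  show "nonassoc_poly_mult (Poly_Mapping.map ((*) c) f) g = Poly_Mapping.map ((*) c) (nonassoc_poly_mult f g)"
  proof (induction f rule: poly_mapping_add_induct)
    case (single u a)
    show ?case
      by (induction g rule: poly_mapping_add_induct)
        (simp_all add: nonassoc_poly_mult_single nonassoc_poly_mult_add_right map_scale_add mult.assoc)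
  qed (simp_all add: nonassoc_poly_mult_add_left map_scale_add)
  show "nonassoc_poly_mult f (Poly_Mapping.map ((*) c) g) = Poly_Mapping.map ((*) c) (nonassoc_poly_mult f g)"
  proof (induction f rule: poly_mapping_add_induct)
    case (single u a)
    show ?case
      by (induction g rule: poly_mapping_add_induct)
        (simp_all add: nonassoc_poly_mult_single nonassoc_poly_mult_add_right map_scale_add mult.left_commute)
  qed (simp_all add: nonassoc_poly_mult_add_left map_scale_add)
qed

lemma (in nonassoc_algebra) eval_poly_mult:
  assumes "\<And>i. \<rho> i \<in> carrier A"
  shows "eval_poly A \<rho> (nonassoc_poly_mult f g) = eval_poly A \<rho> f \<otimes>\<^bsub>A\<^esub> eval_poly A \<rho> g"
proof (induction f rule: poly_mapping_add_induct)
  case (single u a)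
  note [simp] = eval_word_closed[of \<rho>, OF assms] eval_poly_closed[of \<rho>, OF assms] smult_mem
  show ?case
  proof (induction g rule: poly_mapping_add_induct)
    case (single v b)
    then show ?case
      by (simp add: nonassoc_poly_mult_single eval_poly_single assms mult_smult_left
          mult_smult_right mult_closed flip: smult_smult)
        (simp add: mult.commute)
  qed (simp_all add: eval_poly_zero mult_zero nonassoc_poly_mult_add_right eval_poly_add assms mult_add_right)
qed (simp_all add: eval_poly_zero zero_mult nonassoc_poly_mult_add_left eval_poly_add assms
    eval_poly_closed mult_add_left)

lemma free_nonassoc_algebra_simps [simp]:
  "carrier (free_nonassoc_algebra V) = {f. \<forall>w\<in>Poly_Mapping.keys f. letters w \<subseteq> V}"
  "f \<otimes>\<^bsub>free_nonassoc_algebra V\<^esub> g = nonassoc_poly_mult f g"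
  "f \<oplus>\<^bsub>free_nonassoc_algebra V\<^esub> g = f + g"
  "\<zero>\<^bsub>free_nonassoc_algebra V\<^esub> = 0"
  "c \<odot>\<^bsub>free_nonassoc_algebra V\<^esub> f = Poly_Mapping.map ((*) c) f"
  by (simp_all add: free_nonassoc_algebra_def)

lemma keys_nonassoc_poly_mult:
  "Poly_Mapping.keys (nonassoc_poly_mult f g) \<subseteq>
    (\<Union>u\<in>Poly_Mapping.keys f. \<Union>v\<in>Poly_Mapping.keys g. {Juxt u v})"
proof
  fix w assume "w \<in> Poly_Mapping.keys (nonassoc_poly_mult f g)"
  then have "(\<Sum>u\<in>Poly_Mapping.keys f. \<Sum>v\<in>Poly_Mapping.keys g.
      Poly_Mapping.lookup (Poly_Mapping.single (Juxt u v) (Poly_Mapping.lookup f u * Poly_Mapping.lookup g v)) w) \<noteq> 0"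
    by (simp add: in_keys_iff nonassoc_poly_mult_def lookup_sum)
  then obtain u v where "u \<in> Poly_Mapping.keys f" "v \<in> Poly_Mapping.keys g"
    "Poly_Mapping.lookup (Poly_Mapping.single (Juxt u v) (Poly_Mapping.lookup f u * Poly_Mapping.lookup g v)) w \<noteq> 0"
    by (meson sum.not_neutral_contains_not_neutral)
  then show "w \<in> (\<Union>u\<in>Poly_Mapping.keys f. \<Union>v\<in>Poly_Mapping.keys g. {Juxt u v})"
    by (auto simp: lookup_single when_def split: if_splits)
qed

lemma nonassoc_algebra_free: "nonassoc_algebra (free_nonassoc_algebra V :: ('k::field, _) module)"
proof -
  let ?F = "free_nonassoc_algebra V :: ('k, _) module"
  have "abelian_group ?F"
  proof (rule abelian_groupI)
    fix f assume "f \<in> carrier ?F"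
    then show "\<exists>g\<in>carrier ?F. g \<oplus>\<^bsub>?F\<^esub> f = \<zero>\<^bsub>?F\<^esub>"
      by (intro bexI[of _ "- f"]) (auto simp: in_keys_iff)
  qed (auto simp: add_ac dest: subsetD[OF keys_add])
  then have "module ring_of_type_algebra ?F"
  proof (intro moduleI cring_from_type_algebra)
    fix c f assume "f \<in> carrier ?F"
    then show "c \<odot>\<^bsub>?F\<^esub> f \<in> carrier ?F" by (auto simp: in_keys_iff)
  qed (auto simp: poly_mapping_eq_iff fun_eq_iff lookup_add algebra_simps)
  moreover have "nonassoc_algebra_axioms ?F"
    by unfold_locales
      (auto simp: nonassoc_poly_mult_add_left nonassoc_poly_mult_add_right nonassoc_poly_mult_scale
        dest!: subsetD[OF keys_nonassoc_poly_mult], blast+)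
  ultimately show ?thesis by (simp add: nonassoc_algebra_def)
qed

context nonassoc_algebra
begin

lemma algebra_idealI:
  assumes "I \<subseteq> carrier A" "\<zero>\<^bsub>A\<^esub> \<in> I" "\<And>x y. x \<in> I \<Longrightarrow> y \<in> I \<Longrightarrow> x \<oplus>\<^bsub>A\<^esub> y \<in> I"
    "\<And>c x. x \<in> I \<Longrightarrow> c \<odot>\<^bsub>A\<^esub> x \<in> I"
    "\<And>a x. a \<in> carrier A \<Longrightarrow> x \<in> I \<Longrightarrow> a \<otimes>\<^bsub>A\<^esub> x \<in> I"
    "\<And>a x. a \<in> carrier A \<Longrightarrow> x \<in> I \<Longrightarrow> x \<otimes>\<^bsub>A\<^esub> a \<in> I"
  shows "algebra_ideal I A"
proof -
  have "\<ominus>\<^bsub>A\<^esub> x \<in> I" if "x \<in> I" for x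
  proof -
    have x: "x \<in> carrier A" using that assms(1) by auto
    have "(-1) \<odot>\<^bsub>A\<^esub> x \<oplus>\<^bsub>A\<^esub> x = \<zero>\<^bsub>A\<^esub>"
      using x smult_add_left[of x "-1" 1] smult_one[of x] by (simp add: zero_smult)
    then have "\<ominus>\<^bsub>A\<^esub> x = (-1) \<odot>\<^bsub>A\<^esub> x" using x minus_equality smult_mem by blast
    then show ?thesis using assms(4) that by simp
  qed
  then show ?thesis unfolding algebra_ideal_def using assms by (auto intro!: submoduleI)
qed

lemma algebra_idealD:
  assumes "algebra_ideal I A"
  shows "I \<subseteq> carrier A" "\<zero>\<^bsub>A\<^esub> \<in> I" "\<And>x y. x \<in> I \<Longrightarrow> y \<in> I \<Longrightarrow> x \<oplus>\<^bsub>A\<^esub> y \<in> I"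
    "\<And>c x. x \<in> I \<Longrightarrow> c \<odot>\<^bsub>A\<^esub> x \<in> I"
    "\<And>a x. a \<in> carrier A \<Longrightarrow> x \<in> I \<Longrightarrow> a \<otimes>\<^bsub>A\<^esub> x \<in> I"
    "\<And>a x. a \<in> carrier A \<Longrightarrow> x \<in> I \<Longrightarrow> x \<otimes>\<^bsub>A\<^esub> a \<in> I"
    "abelian_subgroup I A"
proof -
  have sm: "submodule I ring_of_type_algebra A" using assms by (simp add: algebra_ideal_def)
  note E = submoduleE[OF sm]
  show "I \<subseteq> carrier A" "\<And>x y. x \<in> I \<Longrightarrow> y \<in> I \<Longrightarrow> x \<oplus>\<^bsub>A\<^esub> y \<in> I" using E by auto
  show smul: "\<And>c x. x \<in> I \<Longrightarrow> c \<odot>\<^bsub>A\<^esub> x \<in> I" using E(4) by simp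
  obtain x where "x \<in> I" using E(2) by blast
  then show "\<zero>\<^bsub>A\<^esub> \<in> I" using E(1) smul[of x 0] zero_smult[of x] by auto
  show "\<And>a x. a \<in> carrier A \<Longrightarrow> x \<in> I \<Longrightarrow> a \<otimes>\<^bsub>A\<^esub> x \<in> I"
    "\<And>a x. a \<in> carrier A \<Longrightarrow> x \<in> I \<Longrightarrow> x \<otimes>\<^bsub>A\<^esub> a \<in> I"
    using assms by (auto simp: algebra_ideal_def)
  show "abelian_subgroup I A"
    using sm by (intro abelian_subgroupI3 additive_subgroup.intro) (simp_all add: submodule_def M.abelian_group_axioms)
qed

lemma algebra_ideal_generated:
  assumes "S \<subseteq> carrier A"
  shows "algebra_ideal (generated_ideal A S) A" "S \<subseteq> generated_ideal A S"
proof -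
  have "algebra_ideal (carrier A) A"
    by (intro algebra_idealI) (auto simp: smult_mem mult_closed)
  then have sub: "generated_ideal A S \<subseteq> carrier A" using assms by (auto simp: generated_ideal_def)
  show "algebra_ideal (generated_ideal A S) A"
    by (intro algebra_idealI sub) (auto simp: generated_ideal_def algebra_idealD)
  show "S \<subseteq> generated_ideal A S" by (auto simp: generated_ideal_def)
qed

end

locale algebra_hom = A: nonassoc_algebra A + B: nonassoc_algebra B
  for A :: "('k::field, 'a) module" and B :: "('k, 'b) module" +
  fixes h :: "'a \<Rightarrow> 'b"
  assumes hom_closed: "x \<in> carrier A \<Longrightarrow> h x \<in> carrier B"
    and hom_add: "\<lbrakk>x \<in> carrier A; y \<in> carrier A\<rbrakk> \<Longrightarrow> h (x \<oplus>\<^bsub>A\<^esub> y) = h x \<oplus>\<^bsub>B\<^esub> h y"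
    and hom_smult: "x \<in> carrier A \<Longrightarrow> h (c \<odot>\<^bsub>A\<^esub> x) = c \<odot>\<^bsub>B\<^esub> h x"
    and hom_mult: "\<lbrakk>x \<in> carrier A; y \<in> carrier A\<rbrakk> \<Longrightarrow> h (x \<otimes>\<^bsub>A\<^esub> y) = h x \<otimes>\<^bsub>B\<^esub> h y"
begin

lemma hom_zero: "h \<zero>\<^bsub>A\<^esub> = \<zero>\<^bsub>B\<^esub>"
  using hom_smult[of "\<zero>\<^bsub>A\<^esub>" 0] hom_closed[of "\<zero>\<^bsub>A\<^esub>"] by (simp add: A.zero_smult B.zero_smult)

lemma hom_uminus: "x \<in> carrier A \<Longrightarrow> h (\<ominus>\<^bsub>A\<^esub> x) = \<ominus>\<^bsub>B\<^esub> h x"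
  using hom_add[of "\<ominus>\<^bsub>A\<^esub> x" x] hom_closed
  by (metis A.M.a_inv_closed A.M.l_neg B.M.minus_equality hom_zero)

lemma hom_minus: "\<lbrakk>x \<in> carrier A; y \<in> carrier A\<rbrakk> \<Longrightarrow> h (x \<ominus>\<^bsub>A\<^esub> y) = h x \<ominus>\<^bsub>B\<^esub> h y"
  by (simp add: a_minus_def hom_add hom_uminus)

lemma hom_eval_word:
  assumes "\<And>i. \<rho> i \<in> carrier A"
  shows "h (eval_word A \<rho> w) = eval_word B (\<lambda>i. h (\<rho> i)) w"
  by (induction w) (simp_all add: hom_mult A.eval_word_closed[of \<rho>, OF assms])

lemma hom_eval_poly:
  assumes "\<And>i. \<rho> i \<in> carrier A"
  shows "h (eval_poly A \<rho> f) = eval_poly B (\<lambda>i. h (\<rho> i)) f"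
  by (induction f rule: poly_mapping_add_induct)
    (simp_all add: A.eval_poly_zero B.eval_poly_zero hom_zero A.eval_poly_single[of \<rho>, OF assms]
      B.eval_poly_single hom_closed assms hom_smult A.eval_word_closed hom_eval_word
      A.eval_poly_add[of \<rho>, OF assms] B.eval_poly_add hom_add A.eval_poly_closed)

lemma kernel_ideal: "algebra_ideal {x \<in> carrier A. h x = \<zero>\<^bsub>B\<^esub>} A"
  by (intro A.algebra_idealI)
    (auto simp: hom_zero hom_add hom_smult hom_mult A.smult_mem A.mult_closed B.smult_r_null
      B.mult_zero B.zero_mult hom_closed)

lemma generated_ideal_in_kernel:
  assumes "S \<subseteq> carrier A" "\<And>x. x \<in> S \<Longrightarrow> h x = \<zero>\<^bsub>B\<^esub>" "x \<in> generated_ideal A S"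
  shows "h x = \<zero>\<^bsub>B\<^esub>"
  using assms kernel_ideal unfolding generated_ideal_def by blast

end

lemma (in nonassoc_algebra) minus_eq_zeroD:
  assumes "a \<ominus>\<^bsub>A\<^esub> b = \<zero>\<^bsub>A\<^esub>" "a \<in> carrier A" "b \<in> carrier A"
  shows "a = b"
  using assms by (metis a_minus_def M.minus_equality M.minus_minus M.a_inv_closed)

lemma novikov_varietyD:
  assumes "A \<in> novikov_variety"
  shows "nonassoc_algebra A"
    "\<lbrakk>x \<in> carrier A; y \<in> carrier A; z \<in> carrier A\<rbrakk> \<Longrightarrow>
      (x \<otimes>\<^bsub>A\<^esub> y) \<otimes>\<^bsub>A\<^esub> z \<ominus>\<^bsub>A\<^esub> x \<otimes>\<^bsub>A\<^esub> (y \<otimes>\<^bsub>A\<^esub> z) =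
        (x \<otimes>\<^bsub>A\<^esub> z) \<otimes>\<^bsub>A\<^esub> y \<ominus>\<^bsub>A\<^esub> x \<otimes>\<^bsub>A\<^esub> (z \<otimes>\<^bsub>A\<^esub> y)"
    "\<lbrakk>x \<in> carrier A; y \<in> carrier A; z \<in> carrier A\<rbrakk> \<Longrightarrow>
      x \<otimes>\<^bsub>A\<^esub> (y \<otimes>\<^bsub>A\<^esub> z) = y \<otimes>\<^bsub>A\<^esub> (x \<otimes>\<^bsub>A\<^esub> z)"
  using assms by (auto simp: novikov_variety_def)

lemma (in nonassoc_algebra) novikov_relators_closed: "novikov_relators A \<subseteq> carrier A"
  by (auto simp: novikov_relators_def mult_closed)

lemma (in algebra_hom) novikov_ideal_in_kernel:
  assumes B: "B \<in> novikov_variety" and x: "x \<in> generated_ideal A (novikov_relators A)"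
  shows "h x = \<zero>\<^bsub>B\<^esub>"
proof (rule generated_ideal_in_kernel[OF A.novikov_relators_closed _ x])
  fix r assume "r \<in> novikov_relators A"
  then consider x y z where "x \<in> carrier A" "y \<in> carrier A" "z \<in> carrier A"
      "r = ((x \<otimes>\<^bsub>A\<^esub> y) \<otimes>\<^bsub>A\<^esub> z \<ominus>\<^bsub>A\<^esub> x \<otimes>\<^bsub>A\<^esub> (y \<otimes>\<^bsub>A\<^esub> z)) \<ominus>\<^bsub>A\<^esub>
        ((x \<otimes>\<^bsub>A\<^esub> z) \<otimes>\<^bsub>A\<^esub> y \<ominus>\<^bsub>A\<^esub> x \<otimes>\<^bsub>A\<^esub> (z \<otimes>\<^bsub>A\<^esub> y))"
    | x y z where "x \<in> carrier A" "y \<in> carrier A" "z \<in> carrier A"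
      "r = x \<otimes>\<^bsub>A\<^esub> (y \<otimes>\<^bsub>A\<^esub> z) \<ominus>\<^bsub>A\<^esub> y \<otimes>\<^bsub>A\<^esub> (x \<otimes>\<^bsub>A\<^esub> z)"
    unfolding novikov_relators_def by blast
  then show "h r = \<zero>\<^bsub>B\<^esub>"
  proof cases
    case 1
    then show ?thesis
      using novikov_varietyD(2)[OF B, of "h x" "h y" "h z"]
      by (simp add: hom_minus hom_mult A.mult_closed hom_closed B.mult_closed)
        (simp add: a_minus_def[of B _ "_ \<ominus>\<^bsub>B\<^esub> _"] B.M.r_neg hom_closed B.mult_closed)
  next
    case 2
    then show ?thesis
      using novikov_varietyD(3)[OF B, of "h x" "h y" "h z"]
      by (simp add: hom_minus hom_mult A.mult_closed hom_closed B.mult_closed)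
        (simp add: a_minus_def B.M.r_neg hom_closed B.mult_closed)
  qed
qed

text \<open>
  The universal property of the free nonassociative algebra.
\<close>

lemma eval_poly_hom:
  fixes A :: "('k::field, 'a) module" and \<rho> :: "'x \<Rightarrow> 'a"
  assumes "nonassoc_algebra A" "\<And>i. \<rho> i \<in> carrier A"
  shows "algebra_hom (free_nonassoc_algebra V) A (eval_poly A \<rho>)"
proof -
  interpret nonassoc_algebra A by fact
  interpret F: nonassoc_algebra "free_nonassoc_algebra V :: ('k, ('x,'k) nonassoc_poly) module"
    by (rule nonassoc_algebra_free)
  show ?thesis
    by unfold_locales (simp_all add: eval_poly_closed assms eval_poly_add eval_poly_mult eval_poly_smult)
qed

text \<open>
  The union in the definition of scalar multiplication and product of cosets is over equal cosets,
  because \<open>I\<close> is an ideal; hence both operations can be computed on representatives, and all axioms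
  pass to the quotient.
\<close>

lemma quotient_algebra_hom:
  assumes A: "nonassoc_algebra A" and I: "algebra_ideal I A"
  shows "algebra_hom A (quotient_algebra A I) (\<lambda>x. I +>\<^bsub>A\<^esub> x)"
proof -
  interpret A: nonassoc_algebra A by fact
  note D = A.algebra_idealD[OF I]
  interpret I: abelian_subgroup I A by (rule D(7))
  let ?Q = "quotient_algebra A I"
  have memI: "y \<in> I +>\<^bsub>A\<^esub> x \<longleftrightarrow> (\<exists>i\<in>I. y = i \<oplus>\<^bsub>A\<^esub> x)" for x y
    by (auto simp: a_r_coset_def')
  have eq: "I +>\<^bsub>A\<^esub> y = I +>\<^bsub>A\<^esub> x" if "i \<in> I" "y = i \<oplus>\<^bsub>A\<^esub> x" "x \<in> carrier A" for i x y
    using that A.M.a_repr_independence[of y I x] I.a_subgroup memI by blast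
  \<comment> \<open>A union of pairwise equal cosets.\<close>
  have union: "(\<Union>y\<in>I +>\<^bsub>A\<^esub> x. I +>\<^bsub>A\<^esub> g y) = I +>\<^bsub>A\<^esub> g x"
    if "x \<in> carrier A" "\<And>i. i \<in> I \<Longrightarrow> I +>\<^bsub>A\<^esub> g (i \<oplus>\<^bsub>A\<^esub> x) = I +>\<^bsub>A\<^esub> g x" for g x
    using that I.a_rcos_self[OF that(1)] memI by fastforce
  have carr: "i \<in> carrier A" if "i \<in> I" for i using that D(1) by auto
  have smult: "c \<odot>\<^bsub>?Q\<^esub> (I +>\<^bsub>A\<^esub> x) = I +>\<^bsub>A\<^esub> (c \<odot>\<^bsub>A\<^esub> x)" if "x \<in> carrier A" for c x
  proof -
    have "(\<Union>y\<in>I +>\<^bsub>A\<^esub> x. I +>\<^bsub>A\<^esub> (c \<odot>\<^bsub>A\<^esub> y)) = I +>\<^bsub>A\<^esub> (c \<odot>\<^bsub>A\<^esub> x)"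
    proof (rule union[OF that])
      fix i assume "i \<in> I"
      then show "I +>\<^bsub>A\<^esub> (c \<odot>\<^bsub>A\<^esub> (i \<oplus>\<^bsub>A\<^esub> x)) = I +>\<^bsub>A\<^esub> (c \<odot>\<^bsub>A\<^esub> x)"
        using that by (intro eq[of "c \<odot>\<^bsub>A\<^esub> i"]) (simp_all add: D(4) carr A.smult_add_right A.smult_mem)
    qed
    then show ?thesis by (simp add: quotient_algebra_def)
  qed
  have mult: "(I +>\<^bsub>A\<^esub> x) \<otimes>\<^bsub>?Q\<^esub> (I +>\<^bsub>A\<^esub> y) = I +>\<^bsub>A\<^esub> (x \<otimes>\<^bsub>A\<^esub> y)"
    if x: "x \<in> carrier A" and y: "y \<in> carrier A" for x y
  proof -
    have "(\<Union>b\<in>I +>\<^bsub>A\<^esub> y. I +>\<^bsub>A\<^esub> (a \<otimes>\<^bsub>A\<^esub> b)) = I +>\<^bsub>A\<^esub> (a \<otimes>\<^bsub>A\<^esub> y)" if "a \<in> carrier A" for a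
    proof (rule union[OF y])
      fix i assume "i \<in> I"
      then show "I +>\<^bsub>A\<^esub> (a \<otimes>\<^bsub>A\<^esub> (i \<oplus>\<^bsub>A\<^esub> y)) = I +>\<^bsub>A\<^esub> (a \<otimes>\<^bsub>A\<^esub> y)"
        using that y by (intro eq[of "a \<otimes>\<^bsub>A\<^esub> i"]) (simp_all add: D(5) carr A.mult_add_right A.mult_closed)
    qed
    moreover have "a \<in> carrier A" if "a \<in> I +>\<^bsub>A\<^esub> x" for a using that x memI carr by auto
    ultimately have "(\<Union>a\<in>I +>\<^bsub>A\<^esub> x. \<Union>b\<in>I +>\<^bsub>A\<^esub> y. I +>\<^bsub>A\<^esub> (a \<otimes>\<^bsub>A\<^esub> b)) =
        (\<Union>a\<in>I +>\<^bsub>A\<^esub> x. I +>\<^bsub>A\<^esub> (a \<otimes>\<^bsub>A\<^esub> y))" by simp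
    also have "\<dots> = I +>\<^bsub>A\<^esub> (x \<otimes>\<^bsub>A\<^esub> y)"
    proof (rule union[OF x])
      fix i assume "i \<in> I"
      then show "I +>\<^bsub>A\<^esub> ((i \<oplus>\<^bsub>A\<^esub> x) \<otimes>\<^bsub>A\<^esub> y) = I +>\<^bsub>A\<^esub> (x \<otimes>\<^bsub>A\<^esub> y)"
        using x y by (intro eq[of "i \<otimes>\<^bsub>A\<^esub> y"]) (simp_all add: D(6) carr A.mult_add_left A.mult_closed)
    qed
    finally show ?thesis by (simp add: quotient_algebra_def rcoset_mult_def)
  qed
  have add: "(I +>\<^bsub>A\<^esub> x) \<oplus>\<^bsub>?Q\<^esub> (I +>\<^bsub>A\<^esub> y) = I +>\<^bsub>A\<^esub> (x \<oplus>\<^bsub>A\<^esub> y)"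
    if "x \<in> carrier A" "y \<in> carrier A" for x y
    using that by (simp add: quotient_algebra_def I.a_rcos_sum)
  have carrierQ: "carrier ?Q = (\<lambda>x. I +>\<^bsub>A\<^esub> x) ` carrier A"
    by (auto simp: quotient_algebra_def A_RCOSETS_defs a_r_coset_def)
  have zeroQ: "\<zero>\<^bsub>?Q\<^esub> = I +>\<^bsub>A\<^esub> \<zero>\<^bsub>A\<^esub>"
    using A.M.a_coset_add_zero[OF D(1)] by (simp add: quotient_algebra_def)
  have "abelian_group ?Q"
  proof (rule abelian_groupI)
    fix q assume "q \<in> carrier ?Q"
    then obtain x where "x \<in> carrier A" "q = I +>\<^bsub>A\<^esub> x" by (auto simp: carrierQ)
    then show "\<exists>y\<in>carrier ?Q. y \<oplus>\<^bsub>?Q\<^esub> q = \<zero>\<^bsub>?Q\<^esub>"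
      by (intro bexI[of _ "I +>\<^bsub>A\<^esub> (\<ominus>\<^bsub>A\<^esub> x)"]) (auto simp: carrierQ zeroQ add A.M.l_neg)
  qed (auto simp: carrierQ add zeroQ A.M.a_ac)
  then have "module ring_of_type_algebra ?Q"
    by (intro moduleI cring_from_type_algebra)
      (auto simp: carrierQ smult add A.smult_mem A.smult_add_left A.smult_add_right A.smult_smult
        A.smult_one[simplified])
  moreover have "nonassoc_algebra_axioms ?Q"
    by unfold_locales (auto simp: carrierQ smult add mult A.mult_closed A.smult_mem
        A.mult_add_left A.mult_add_right A.mult_smult_left A.mult_smult_right)
  ultimately have "nonassoc_algebra ?Q" by (simp add: nonassoc_algebra_def)
  then interpret Q: nonassoc_algebra ?Q .
  show ?thesis by unfold_locales (simp_all add: smult mult add, simp add: carrierQ)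
qed

lemma quotient_kernel:
  assumes A: "nonassoc_algebra A" and I: "algebra_ideal I A"
    and x: "x \<in> carrier A" "I +>\<^bsub>A\<^esub> x = \<zero>\<^bsub>quotient_algebra A I\<^esub>"
  shows "x \<in> I"
proof -
  interpret A: nonassoc_algebra A by fact
  interpret I: abelian_subgroup I A by (rule A.algebra_idealD(7)[OF I])
  show ?thesis
    using I.a_rcos_self[OF x(1)] x(2) by (simp add: quotient_algebra_def)
qed

lemma free_novikov_in_variety:
  fixes V :: "'x set"
  shows "(free_novikov_algebra V :: ('k::field, ('x, 'k) nonassoc_poly set) module) \<in> novikov_variety"
proof -
  let ?F = "free_nonassoc_algebra V :: ('k, ('x, 'k) nonassoc_poly) module"
  let ?I = "generated_ideal ?F (novikov_relators ?F)"
  let ?Q = "quotient_algebra ?F ?I"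
  interpret F: nonassoc_algebra ?F by (rule nonassoc_algebra_free)
  note I = F.algebra_ideal_generated[OF F.novikov_relators_closed]
  interpret h: algebra_hom ?F ?Q "\<lambda>x. ?I +>\<^bsub>?F\<^esub> x"
    by (rule quotient_algebra_hom[OF nonassoc_algebra_free I(1)])
  interpret I: abelian_subgroup ?I ?F by (rule F.algebra_idealD(7)[OF I(1)])
  have carrier: "carrier ?Q = (\<lambda>x. ?I +>\<^bsub>?F\<^esub> x) ` carrier ?F"
    by (auto simp: quotient_algebra_def A_RCOSETS_defs a_r_coset_def)
  have kill: "?I +>\<^bsub>?F\<^esub> r = \<zero>\<^bsub>?Q\<^esub>" if "r \<in> novikov_relators ?F" for r
  proof -
    have "r \<in> ?I" using that I(2) by blast
    then have "?I +>\<^bsub>?F\<^esub> r = ?I" by (rule I.a_rcos_const)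
    then show ?thesis by (simp add: quotient_algebra_def)
  qed
  have "(x \<otimes>\<^bsub>?Q\<^esub> y) \<otimes>\<^bsub>?Q\<^esub> z \<ominus>\<^bsub>?Q\<^esub> x \<otimes>\<^bsub>?Q\<^esub> (y \<otimes>\<^bsub>?Q\<^esub> z) =
        (x \<otimes>\<^bsub>?Q\<^esub> z) \<otimes>\<^bsub>?Q\<^esub> y \<ominus>\<^bsub>?Q\<^esub> x \<otimes>\<^bsub>?Q\<^esub> (z \<otimes>\<^bsub>?Q\<^esub> y) \<and>
      x \<otimes>\<^bsub>?Q\<^esub> (y \<otimes>\<^bsub>?Q\<^esub> z) = y \<otimes>\<^bsub>?Q\<^esub> (x \<otimes>\<^bsub>?Q\<^esub> z)"
    if xyz: "x \<in> carrier ?Q" "y \<in> carrier ?Q" "z \<in> carrier ?Q" for x y z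
  proof -
    obtain a b c where *: "a \<in> carrier ?F" "b \<in> carrier ?F" "c \<in> carrier ?F"
      "x = ?I +>\<^bsub>?F\<^esub> a" "y = ?I +>\<^bsub>?F\<^esub> b" "z = ?I +>\<^bsub>?F\<^esub> c"
      using xyz unfolding carrier by blast
    note homs = h.hom_minus h.hom_mult F.mult_closed F.M.minus_closed *(1-3)
    have "((a \<otimes>\<^bsub>?F\<^esub> b) \<otimes>\<^bsub>?F\<^esub> c \<ominus>\<^bsub>?F\<^esub> a \<otimes>\<^bsub>?F\<^esub> (b \<otimes>\<^bsub>?F\<^esub> c)) \<ominus>\<^bsub>?F\<^esub>
        ((a \<otimes>\<^bsub>?F\<^esub> c) \<otimes>\<^bsub>?F\<^esub> b \<ominus>\<^bsub>?F\<^esub> a \<otimes>\<^bsub>?F\<^esub> (c \<otimes>\<^bsub>?F\<^esub> b)) \<in> novikov_relators ?F"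
      unfolding novikov_relators_def using *(1-3) by blast
    from kill[OF this]
    have 1: "((x \<otimes>\<^bsub>?Q\<^esub> y) \<otimes>\<^bsub>?Q\<^esub> z \<ominus>\<^bsub>?Q\<^esub> x \<otimes>\<^bsub>?Q\<^esub> (y \<otimes>\<^bsub>?Q\<^esub> z)) \<ominus>\<^bsub>?Q\<^esub>
        ((x \<otimes>\<^bsub>?Q\<^esub> z) \<otimes>\<^bsub>?Q\<^esub> y \<ominus>\<^bsub>?Q\<^esub> x \<otimes>\<^bsub>?Q\<^esub> (z \<otimes>\<^bsub>?Q\<^esub> y)) = \<zero>\<^bsub>?Q\<^esub>"
      unfolding *(4-6) by (simp only: homs)
    have "a \<otimes>\<^bsub>?F\<^esub> (b \<otimes>\<^bsub>?F\<^esub> c) \<ominus>\<^bsub>?F\<^esub> b \<otimes>\<^bsub>?F\<^esub> (a \<otimes>\<^bsub>?F\<^esub> c) \<in> novikov_relators ?F"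
      unfolding novikov_relators_def using *(1-3) by blast
    from kill[OF this]
    have 2: "x \<otimes>\<^bsub>?Q\<^esub> (y \<otimes>\<^bsub>?Q\<^esub> z) \<ominus>\<^bsub>?Q\<^esub> y \<otimes>\<^bsub>?Q\<^esub> (x \<otimes>\<^bsub>?Q\<^esub> z) = \<zero>\<^bsub>?Q\<^esub>"
      unfolding *(4-6) by (simp only: homs)
    show ?thesis
      using h.B.minus_eq_zeroD[OF 1] h.B.minus_eq_zeroD[OF 2] xyz
      by (simp add: h.B.mult_closed h.B.M.minus_closed)
  qed
  then show ?thesis
    unfolding free_novikov_algebra_def novikov_variety_def using h.B.nonassoc_algebra_axioms by blast
qed

section \<open>Differential polynomials\<close>

text \<open>
  The pair \<open>(x, n)\<close> is the \<open>n\<close>-th derivative of the differential variable \<open>x\<close>. Multisets of such pairs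
  form a monoid under addition, so that the convolution product on polynomial mappings is the
  product of differential polynomials.
\<close>

type_synonym ('x, 'k) diff_poly = "('x \<times> nat) multiset \<Rightarrow>\<^sub>0 'k"

abbreviation unit_monom :: "'a \<Rightarrow> ('a \<Rightarrow>\<^sub>0 'k::zero_neq_one)" where
  "unit_monom m \<equiv> Poly_Mapping.single m 1"

abbreviation scale :: "'k::semiring_0 \<Rightarrow> ('a \<Rightarrow>\<^sub>0 'k) \<Rightarrow> ('a \<Rightarrow>\<^sub>0 'k)" where
  "scale c \<equiv> Poly_Mapping.map ((*) c)"

lemma scale_scale: "scale a (scale b p) = scale (a * b) (p :: 'a \<Rightarrow>\<^sub>0 'k::comm_ring_1)"
  by (rule poly_mapping_eqI) (simp add: mult.assoc)

lemma scale_add_left: "scale (a + b) p = scale a p + scale b (p :: 'a \<Rightarrow>\<^sub>0 'k::comm_ring_1)"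
  by (rule poly_mapping_eqI) (simp add: lookup_add algebra_simps)

lemma map_zero_fun [simp]: "Poly_Mapping.map (\<lambda>_. 0) p = 0"
  by (rule poly_mapping_eqI) (simp add: map.rep_eq when_def)

lemma scale_0 [simp]: "scale 0 p = (0 :: 'a \<Rightarrow>\<^sub>0 'k::comm_ring_1)"
  by (rule poly_mapping_eqI) simp

lemma scale_1 [simp]: "scale 1 p = (p :: 'a \<Rightarrow>\<^sub>0 'k::comm_ring_1)"
  by (rule poly_mapping_eqI) simp

lemma scale_mult:
  fixes p q :: "'a::comm_monoid_add \<Rightarrow>\<^sub>0 'k::comm_ring_1"
  shows "scale c p * q = scale c (p * q)" "p * scale c q = scale c (p * q)"
  by (simp_all add: mult_map_scale_conv_mult mult_ac)

lemma single_eq_scale_monom: "Poly_Mapping.single k c = scale c (unit_monom k :: 'a \<Rightarrow>\<^sub>0 'k::comm_ring_1)"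
  by simp

lemma sum_monoms: "(\<Sum>k\<in>Poly_Mapping.keys p. scale (Poly_Mapping.lookup p k) (unit_monom k)) = (p :: 'a \<Rightarrow>\<^sub>0 'k::comm_ring_1)"
  by (rule poly_mapping_eqI) (simp add: lookup_sum lookup_single when_def sum.delta in_keys_iff)

definition derivation :: "('x, 'k::comm_ring_1) diff_poly \<Rightarrow> ('x, 'k) diff_poly" where
  "derivation p = (\<Sum>k\<in>Poly_Mapping.keys p.
    scale (Poly_Mapping.lookup p k) (\<Sum>x\<in>#k. unit_monom (raise k x)))"

lemma derivation_zero [simp]: "derivation 0 = 0"
  by (simp add: derivation_def)

lemma derivation_add: "derivation (p + q) = derivation p + derivation q"
  unfolding derivation_def by (rule setsum_keys_plus_distrib) (simp_all add: scale_add_left)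

lemma derivation_single: "derivation (Poly_Mapping.single k c) = scale c (\<Sum>x\<in>#k. unit_monom (raise k x))"
  by (simp add: derivation_def)

lemma derivation_scale: "derivation (scale c p) = scale c (derivation p)"
  by (induction p rule: poly_mapping_add_induct)
    (simp_all add: derivation_add derivation_single map_scale_add scale_scale)

lemma derivation_sum: "derivation (\<Sum>i\<in>I. f i) = (\<Sum>i\<in>I. derivation (f i))"
  by (induction I rule: infinite_finite_induct) (simp_all add: derivation_add)

lemma monom_mult: "unit_monom k * unit_monom l = (unit_monom (k + l) :: 'a::comm_monoid_add \<Rightarrow>\<^sub>0 'k::comm_ring_1)"
  by (simp add: mult_single)

lemma sum_mset_monom_raise:
  "(\<Sum>x\<in>#k. unit_monom (raise k x)) * unit_monom l = (\<Sum>x\<in>#k. unit_monom (raise (k + l) x) :: ('x, 'k::comm_ring_1) diff_poly)"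
  unfolding sum_mset_distrib_right multiset.map_comp comp_def
  by (intro arg_cong[where f = sum_mset] image_mset_cong) (simp add: monom_mult raise_add)

lemma derivation_mult: "derivation (p * q) = derivation p * q + p * derivation q"
proof (induction p rule: poly_mapping_add_induct)
  case (single k a)
  show ?case
  proof (induction q rule: poly_mapping_add_induct)
    case (single l b)
    have "(\<Sum>x\<in>#k + l. unit_monom (raise (k + l) x)) =
        (\<Sum>x\<in>#k. unit_monom (raise k x)) * unit_monom l + unit_monom k * (\<Sum>x\<in>#l. unit_monom (raise l x) :: ('a, 'b) diff_poly)"
    proof -
      have "unit_monom k * (\<Sum>x\<in>#l. unit_monom (raise l x)) =
          (\<Sum>x\<in>#l. unit_monom (raise (k + l) x) :: ('a, 'b) diff_poly)"
        using sum_mset_monom_raise[of l k] by (simp add: add.commute mult.commute)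
      then show ?thesis by (simp add: sum_mset_monom_raise)
    qed
    then show ?case
      unfolding mult_single derivation_single
      by (simp add: single_eq_scale_monom[of k a] single_eq_scale_monom[of l b] scale_mult scale_scale
          map_scale_add mult_ac del: map_single)
  qed (simp_all add: derivation_add distrib_left)
qed (simp_all add: derivation_add distrib_right)

text \<open>
  The commutative algebra of differential polynomials with the Novikov product \<open>d(p) \<cdot> q\<close>.
\<close>

definition diff_algebra :: "('k::field, ('x, 'k) diff_poly) module" where
  "diff_algebra = \<lparr>carrier = UNIV, monoid.mult = (\<lambda>p q. derivation p * q), one = undefined,
    zero = 0, add = (+), module.smult = scale\<rparr>"

lemma diff_algebra_simps [simp]:
  "carrier diff_algebra = UNIV" "p \<otimes>\<^bsub>diff_algebra\<^esub> q = derivation p * q" "\<zero>\<^bsub>diff_algebra\<^esub> = 0"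
  "p \<oplus>\<^bsub>diff_algebra\<^esub> q = p + q" "c \<odot>\<^bsub>diff_algebra\<^esub> p = scale c p"
  by (simp_all add: diff_algebra_def)

lemma nonassoc_algebra_diff: "nonassoc_algebra (diff_algebra :: ('k::field, ('x, 'k) diff_poly) module)"
proof -
  let ?D = "diff_algebra :: ('k, ('x, 'k) diff_poly) module"
  have "abelian_group ?D"
  proof (rule abelian_groupI)
    fix f assume "f \<in> carrier ?D"
    show "\<exists>g\<in>carrier ?D. g \<oplus>\<^bsub>?D\<^esub> f = \<zero>\<^bsub>?D\<^esub>" by (intro bexI[of _ "- f"]) auto
  qed (auto simp: add_ac)
  then have "module ring_of_type_algebra ?D"
    by (intro moduleI cring_from_type_algebra)
      (simp_all add: map_scale_add scale_add_left scale_scale)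
  moreover have "nonassoc_algebra_axioms ?D"
    by unfold_locales (simp_all add: derivation_add derivation_scale scale_mult distrib_left distrib_right)
  ultimately show ?thesis by (simp add: nonassoc_algebra_def)
qed

text \<open>
  By the Leibniz rule, \<open>p(qr) = d(p) d(q) r\<close> and \<open>(pq)r - p(qr) = d(d(p)) q r\<close>.
\<close>

lemma diff_algebra_in_variety: "(diff_algebra :: ('k::field, ('x, 'k) diff_poly) module) \<in> novikov_variety"
proof -
  interpret D: nonassoc_algebra "diff_algebra :: ('k, ('x, 'k) diff_poly) module"
    by (rule nonassoc_algebra_diff)
  have "\<ominus>\<^bsub>diff_algebra\<^esub> p = - p" for p :: "('x, 'k) diff_poly"
    by (rule D.M.minus_equality) simp_all
  then show ?thesis
    unfolding novikov_variety_def
    by (simp add: D.nonassoc_algebra_axioms a_minus_def derivation_mult algebra_simps)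
qed

definition to_diff :: "('x, 'k::field) nonassoc_poly \<Rightarrow> ('x, 'k) diff_poly" where
  "to_diff = eval_poly diff_algebra (\<lambda>x. unit_monom {#(x, 0)#})"

lemma to_diff_hom:
  "algebra_hom (free_nonassoc_algebra V) diff_algebra (to_diff :: ('x, 'k::field) nonassoc_poly \<Rightarrow> _)"
  unfolding to_diff_def by (rule eval_poly_hom[OF nonassoc_algebra_diff]) simp

section \<open>Differential polynomials detect Novikov identities\<close>

definition novikov_ideal :: "('x, 'k::field) nonassoc_poly set" where
  "novikov_ideal = generated_ideal (free_nonassoc_algebra UNIV) (novikov_relators (free_nonassoc_algebra UNIV))"

lemma free_uminus: 
  fixes f :: "('x, 'k::field) nonassoc_poly"
  shows "\<ominus>\<^bsub>free_nonassoc_algebra UNIV\<^esub> f = - f"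
proof -
  interpret F: nonassoc_algebra "free_nonassoc_algebra UNIV :: ('k, ('x, 'k) nonassoc_poly) module"
    by (rule nonassoc_algebra_free)
  show ?thesis by (rule F.M.minus_equality) simp_all
qed

lemma novikov_ideal_closed:
  fixes f g :: "('x, 'k::field) nonassoc_poly"
  shows "0 \<in> (novikov_ideal :: ('x, 'k) nonassoc_poly set)"
    "f \<in> novikov_ideal \<Longrightarrow> g \<in> novikov_ideal \<Longrightarrow> f + g \<in> novikov_ideal"
    "f \<in> novikov_ideal \<Longrightarrow> scale c f \<in> novikov_ideal"
    "f \<in> novikov_ideal \<Longrightarrow> nonassoc_poly_mult f g \<in> novikov_ideal"
    "f \<in> novikov_ideal \<Longrightarrow> nonassoc_poly_mult g f \<in> novikov_ideal"
    "f \<in> novikov_ideal \<Longrightarrow> - f \<in> novikov_ideal"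
    "f \<in> novikov_ideal \<Longrightarrow> g \<in> novikov_ideal \<Longrightarrow> f - g \<in> novikov_ideal"
proof -
  interpret F: nonassoc_algebra "free_nonassoc_algebra UNIV :: ('k, ('x, 'k) nonassoc_poly) module"
    by (rule nonassoc_algebra_free)
  note D = F.algebra_idealD[OF F.algebra_ideal_generated(1)[OF F.novikov_relators_closed],
      folded novikov_ideal_def, simplified]
  show "0 \<in> (novikov_ideal :: ('x, 'k) nonassoc_poly set)" by (rule D(2))
  show add: "f \<in> novikov_ideal \<Longrightarrow> g \<in> novikov_ideal \<Longrightarrow> f + g \<in> novikov_ideal"
    for f g :: "('x, 'k) nonassoc_poly" by (rule D(3))
  show scale: "f \<in> novikov_ideal \<Longrightarrow> scale c f \<in> novikov_ideal"
    for f :: "('x, 'k) nonassoc_poly" and c by (rule D(4))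
  show "f \<in> novikov_ideal \<Longrightarrow> nonassoc_poly_mult f g \<in> novikov_ideal" by (rule D(6))
  show "f \<in> novikov_ideal \<Longrightarrow> nonassoc_poly_mult g f \<in> novikov_ideal" by (rule D(5))
  have "scale (- 1) f = - f" for f :: "('x, 'k) nonassoc_poly"
    by (rule poly_mapping_eqI) simp
  then show uminus: "f \<in> novikov_ideal \<Longrightarrow> - f \<in> novikov_ideal" for f :: "('x, 'k) nonassoc_poly"
    using scale[of f "- 1"] by simp
  show "f \<in> novikov_ideal \<Longrightarrow> g \<in> novikov_ideal \<Longrightarrow> f - g \<in> novikov_ideal"
    using add[of f "- g"] uminus[of g] by simp
qed

lemma novikov_ideal_relators:
  fixes f g h :: "('x, 'k::field) nonassoc_poly"
  defines "m \<equiv> (nonassoc_poly_mult :: ('x, 'k) nonassoc_poly \<Rightarrow> _)"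
  shows "(m (m f g) h - m f (m g h)) - (m (m f h) g - m f (m h g)) \<in> novikov_ideal"
    "m f (m g h) - m g (m f h) \<in> novikov_ideal"
proof -
  let ?F = "free_nonassoc_algebra UNIV :: ('k, ('x, 'k) nonassoc_poly) module"
  interpret F: nonassoc_algebra ?F by (rule nonassoc_algebra_free)
  have minus: "a \<ominus>\<^bsub>?F\<^esub> b = a - b" for a b :: "('x, 'k) nonassoc_poly"
    unfolding a_minus_def free_uminus by simp
  have sub: "novikov_relators ?F \<subseteq> novikov_ideal"
    unfolding novikov_ideal_def by (rule F.algebra_ideal_generated(2)[OF F.novikov_relators_closed])
  have "(m (m f g) h - m f (m g h)) - (m (m f h) g - m f (m h g)) \<in> novikov_relators ?F"
    unfolding novikov_relators_def minus m_def by (rule UnI1) force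
  then show "(m (m f g) h - m f (m g h)) - (m (m f h) g - m f (m h g)) \<in> novikov_ideal"
    using sub by blast
  have "m f (m g h) - m g (m f h) \<in> novikov_relators ?F"
    unfolding novikov_relators_def minus m_def by (rule UnI2) force
  then show "m f (m g h) - m g (m f h) \<in> novikov_ideal" using sub by blast
qed

lemma nonassoc_poly_mult_diff:
  "nonassoc_poly_mult (f - g) h = nonassoc_poly_mult f h - nonassoc_poly_mult g h"
  "nonassoc_poly_mult h (f - g) = nonassoc_poly_mult h f - nonassoc_poly_mult h g"
  using nonassoc_poly_mult_add_left[of "f - g" g h] nonassoc_poly_mult_add_right[of h "f - g" g]
  by simp_all

lemma scale_diff: "scale c (f - g) = scale c f - scale c (g :: 'a \<Rightarrow>\<^sub>0 'k::comm_ring_1)"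
  using map_scale_add[of c "f - g" g] by simp

text \<open>
  The free Novikov algebra on all letters as a type with a group structure, so that the map
  \<open>eval_monomial\<close> of the locale \<open>novikov_product\<close> becomes available for it.
\<close>

quotient_type (overloaded) ('x, 'k) novikov = "('x, 'k::field) nonassoc_poly" / "\<lambda>f g. f - g \<in> novikov_ideal"
proof (rule equivpI)
  show "reflp (\<lambda>f g. f - g \<in> (novikov_ideal :: ('x, 'k) nonassoc_poly set))"
    by (rule reflpI) (simp add: novikov_ideal_closed)
  show "symp (\<lambda>f g. f - g \<in> (novikov_ideal :: ('x, 'k) nonassoc_poly set))"
    by (rule sympI) (metis novikov_ideal_closed(6) minus_diff_eq)
  show "transp (\<lambda>f g. f - g \<in> (novikov_ideal :: ('x, 'k) nonassoc_poly set))"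
  proof (rule transpI)
    fix f g h :: "('x, 'k) nonassoc_poly"
    assume "f - g \<in> novikov_ideal" "g - h \<in> novikov_ideal"
    from novikov_ideal_closed(2)[OF this] show "f - h \<in> novikov_ideal" by simp
  qed
qed

instantiation novikov :: (type, field) ab_group_add
begin

lift_definition zero_novikov :: "('a, 'b) novikov" is 0 .

lift_definition plus_novikov :: "('a, 'b) novikov \<Rightarrow> ('a, 'b) novikov \<Rightarrow> ('a, 'b) novikov" is "(+)"
  using novikov_ideal_closed(2) by (metis add_diff_add)

lift_definition uminus_novikov :: "('a, 'b) novikov \<Rightarrow> ('a, 'b) novikov" is uminus
  using novikov_ideal_closed(6) by fastforce

lift_definition minus_novikov :: "('a, 'b) novikov \<Rightarrow> ('a, 'b) novikov \<Rightarrow> ('a, 'b) novikov" is "(-)"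
proof -
  fix f f' g g' :: "('a, 'b) nonassoc_poly"
  assume "f - f' \<in> novikov_ideal" "g - g' \<in> novikov_ideal"
  from novikov_ideal_closed(7)[OF this] show "f - g - (f' - g') \<in> novikov_ideal"
    by (simp add: algebra_simps)
qed

instance
  by standard (transfer, simp add: novikov_ideal_closed algebra_simps)+

end

lift_definition novikov_mul :: "('x, 'k::field) novikov \<Rightarrow> ('x, 'k) novikov \<Rightarrow> ('x, 'k) novikov"
  is nonassoc_poly_mult
proof -
  fix f f' g g' :: "('x, 'k) nonassoc_poly"
  assume "f - f' \<in> novikov_ideal" "g - g' \<in> novikov_ideal"
  then have "nonassoc_poly_mult (f - f') g + nonassoc_poly_mult f' (g - g') \<in> novikov_ideal"
    by (simp only: novikov_ideal_closed(2,4,5))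
  then show "nonassoc_poly_mult f g - nonassoc_poly_mult f' g' \<in> novikov_ideal"
    by (simp add: nonassoc_poly_mult_diff)
qed

lift_definition novikov_scale :: "'k::field \<Rightarrow> ('x, 'k) novikov \<Rightarrow> ('x, 'k) novikov" is scale
  by (metis scale_diff novikov_ideal_closed(3))

interpretation novikov: novikov_product novikov_mul
proof
  fix x y z :: "('x, 'k::field) novikov"
  show "novikov_mul (x + y) z = novikov_mul x z + novikov_mul y z"
    by transfer (simp add: nonassoc_poly_mult_add_left novikov_ideal_closed)
  show "novikov_mul x (y + z) = novikov_mul x y + novikov_mul x z"
    by transfer (simp add: nonassoc_poly_mult_add_right novikov_ideal_closed)
  show "novikov_mul (novikov_mul x y) z - novikov_mul x (novikov_mul y z) =
      novikov_mul (novikov_mul x z) y - novikov_mul x (novikov_mul z y)"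
    by transfer (rule novikov_ideal_relators)
  show "novikov_mul x (novikov_mul y z) = novikov_mul y (novikov_mul x z)"
    by transfer (rule novikov_ideal_relators)
qed

lemma novikov_scale_simps:
  fixes v w :: "('x, 'k::field) novikov"
  shows "novikov_scale 0 v = 0" "novikov_scale 1 v = v" "novikov_scale c 0 = (0 :: ('x, 'k) novikov)"
    "novikov_scale (a + b) v = novikov_scale a v + novikov_scale b v"
    "novikov_scale c (v + w) = novikov_scale c v + novikov_scale c w"
    "novikov_scale a (novikov_scale b v) = novikov_scale (a * b) v"
    "novikov_mul (novikov_scale c v) w = novikov_scale c (novikov_mul v w)"
    "novikov_mul v (novikov_scale c w) = novikov_scale c (novikov_mul v w)"
  by (transfer, simp add: novikov_ideal_closed scale_add_left map_scale_add scale_scale nonassoc_poly_mult_scale)+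

text \<open>
  Evaluates a differential polynomial in the free Novikov algebra, each variable at the class of the
  letter with the same name.
\<close>

definition from_diff :: "('x, 'k::field) diff_poly \<Rightarrow> ('x, 'k) novikov" where
  "from_diff p = (\<Sum>m\<in>Poly_Mapping.keys p. novikov_scale (Poly_Mapping.lookup p m)
    (novikov.eval_monomial (image_mset (apfst (\<lambda>x. abs_novikov (unit_monom (Letter x)))) m)))"

lemma from_diff_zero [simp]: "from_diff 0 = 0"
  by (simp add: from_diff_def)

lemma from_diff_add: "from_diff (p + q) = from_diff p + from_diff q"
  unfolding from_diff_def by (rule setsum_keys_plus_distrib) (simp_all add: novikov_scale_simps)

lemma from_diff_single: "from_diff (Poly_Mapping.single m c) = novikov_scale c
    (novikov.eval_monomial (image_mset (apfst (\<lambda>x. abs_novikov (unit_monom (Letter x)))) m))"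
  by (simp add: from_diff_def novikov_scale_simps)

lemma from_diff_scale: "from_diff (scale c p) = novikov_scale c (from_diff p)"
  by (induction p rule: poly_mapping_add_induct)
    (simp_all add: from_diff_add from_diff_single novikov_scale_simps map_scale_add)

lemma from_diff_sum: "from_diff (\<Sum>i\<in>I. f i) = (\<Sum>i\<in>I. from_diff (f i))"
  by (induction I rule: infinite_finite_induct) (simp_all add: from_diff_add)

lemma from_diff_sum_mset: "from_diff (\<Sum>i\<in>#I. f i) = (\<Sum>i\<in>#I. from_diff (f i))"
  by (induction I) (simp_all add: from_diff_add)

lemma image_mset_raise: "x \<in># k \<Longrightarrow> image_mset (apfst g) (raise k x) = raise (image_mset (apfst g) k) (apfst g x)"
  by (auto simp: raise_def apfst_def map_prod_def split: prod.splits dest!: multi_member_split)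

lemma admissible_image: "admissible (image_mset (apfst g) m) = admissible m"
  by (simp add: admissible_def multiset.map_comp comp_def)

lemma from_diff_unit_monom_mult:
  fixes k l :: "('x \<times> nat) multiset"
  assumes "admissible k" "admissible l"
  shows "from_diff (derivation (unit_monom k) * unit_monom l :: ('x, 'k::field) diff_poly) = novikov_mul (from_diff (unit_monom k)) (from_diff (unit_monom l))"
proof -
  let ?g = "\<lambda>x. abs_novikov (unit_monom (Letter x)) :: ('x, 'k) novikov"
  have "derivation (unit_monom k) * unit_monom l = (\<Sum>x\<in>#k. unit_monom (raise (k + l) x) :: ('x, 'k) diff_poly)"
    by (simp add: derivation_single sum_mset_monom_raise)
  then have "from_diff (derivation (unit_monom k) * unit_monom l :: ('x, 'k) diff_poly) =
      (\<Sum>x\<in>#k. novikov.eval_monomial (image_mset (apfst ?g) (raise (k + l) x)))"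
    by (simp add: from_diff_sum_mset from_diff_single novikov_scale_simps)
  also have "\<dots> = (\<Sum>x\<in>#k. novikov.eval_monomial
      (raise (image_mset (apfst ?g) k) (apfst ?g x) + image_mset (apfst ?g) l))"
    by (intro arg_cong[where f = sum_mset] image_mset_cong) (simp add: raise_add image_mset_raise)
  also have "\<dots> = (\<Sum>x\<in>#image_mset (apfst ?g) k. novikov.eval_monomial
      (raise (image_mset (apfst ?g) k) x + image_mset (apfst ?g) l))"
    by (simp add: multiset.map_comp comp_def)
  also have "\<dots> = novikov_mul (from_diff (unit_monom k)) (from_diff (unit_monom l))"
    by (subst novikov.eval_monomial_mul[symmetric])
      (simp_all add: assms admissible_image from_diff_single novikov_scale_simps)
  finally show ?thesis .
qed

lemma novikov_mul_sum:
  "novikov_mul (\<Sum>i\<in>I. f i) w = (\<Sum>i\<in>I. novikov_mul (f i) w)"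
  "novikov_mul w (\<Sum>i\<in>I. f i) = (\<Sum>i\<in>I. novikov_mul w (f i))"
  by (induction I rule: infinite_finite_induct; simp add: novikov.distrib_left novikov.distrib_right)+

lemma from_diff_mult:
  assumes p: "\<forall>k\<in>Poly_Mapping.keys p. admissible k" and q: "\<forall>l\<in>Poly_Mapping.keys q. admissible l"
  shows "from_diff (derivation p * q) = novikov_mul (from_diff p) (from_diff q)"
proof -
  define a where "a = Poly_Mapping.lookup p"
  define b where "b = Poly_Mapping.lookup q"
  have p': "p = (\<Sum>k\<in>Poly_Mapping.keys p. scale (a k) (unit_monom k))"
    and q': "q = (\<Sum>l\<in>Poly_Mapping.keys q. scale (b l) (unit_monom l))"
    unfolding a_def b_def by (rule sum_monoms[symmetric])+
  have "derivation p = (\<Sum>k\<in>Poly_Mapping.keys p. scale (a k) (derivation (unit_monom k)))"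
    by (subst p') (simp only: derivation_sum derivation_scale)
  then have "derivation p * q = (\<Sum>k\<in>Poly_Mapping.keys p. scale (a k) (derivation (unit_monom k))) *
      (\<Sum>l\<in>Poly_Mapping.keys q. scale (b l) (unit_monom l))"
    using q' by simp
  also have "\<dots> = (\<Sum>k\<in>Poly_Mapping.keys p. \<Sum>l\<in>Poly_Mapping.keys q.
      scale (a k) (scale (b l) (derivation (unit_monom k) * unit_monom l)))"
    unfolding sum_product scale_mult scale_scale by (simp only: mult.commute)
  finally have "from_diff (derivation p * q) = (\<Sum>k\<in>Poly_Mapping.keys p. \<Sum>l\<in>Poly_Mapping.keys q.
      novikov_scale (a k) (novikov_scale (b l) (novikov_mul (from_diff (unit_monom k)) (from_diff (unit_monom l)))))"
    using p q by (simp add: from_diff_sum from_diff_scale from_diff_unit_monom_mult del: map_single)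
  also have "\<dots> = novikov_mul (\<Sum>k\<in>Poly_Mapping.keys p. novikov_scale (a k) (from_diff (unit_monom k)))
      (\<Sum>l\<in>Poly_Mapping.keys q. novikov_scale (b l) (from_diff (unit_monom l)))"
    unfolding novikov_mul_sum(1) unfolding novikov_mul_sum(2) novikov_scale_simps(6-8)
    by (simp only: mult.commute)
  also have "(\<Sum>k\<in>Poly_Mapping.keys p. novikov_scale (a k) (from_diff (unit_monom k))) = from_diff p"
    by (subst (2) p') (simp only: from_diff_sum from_diff_scale)
  also have "(\<Sum>l\<in>Poly_Mapping.keys q. novikov_scale (b l) (from_diff (unit_monom l))) = from_diff q"
    by (subst (2) q') (simp only: from_diff_sum from_diff_scale)
  finally show ?thesis .
qed

lemma keys_sum_mset_unit_monom: "Poly_Mapping.keys (\<Sum>i\<in>#I. unit_monom (f i) :: 'a \<Rightarrow>\<^sub>0 'k::comm_ring_1) \<subseteq> f ` set_mset I"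
proof (induction I)
  case (add x I)
  then show ?case using keys_add[of "unit_monom (f x)" "\<Sum>i\<in>#I. unit_monom (f i)"] by auto
qed simp

lemma keys_derivation: "Poly_Mapping.keys (derivation p) \<subseteq> {raise k x | k x. k \<in> Poly_Mapping.keys p \<and> x \<in># k}"
proof
  fix m assume "m \<in> Poly_Mapping.keys (derivation p)"
  then have "(\<Sum>k\<in>Poly_Mapping.keys p. Poly_Mapping.lookup p k * Poly_Mapping.lookup (\<Sum>x\<in>#k. unit_monom (raise k x)) m) \<noteq> 0"
    by (simp add: derivation_def in_keys_iff lookup_sum)
  then obtain k where k: "k \<in> Poly_Mapping.keys p"
    "Poly_Mapping.lookup p k * Poly_Mapping.lookup (\<Sum>x\<in>#k. unit_monom (raise k x)) m \<noteq> 0"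
    by (meson sum.not_neutral_contains_not_neutral)
  then have "m \<in> Poly_Mapping.keys (\<Sum>x\<in>#k. unit_monom (raise k x) :: ('a, 'b) diff_poly)"
    by (auto simp: in_keys_iff)
  then show "m \<in> {raise k x | k x. k \<in> Poly_Mapping.keys p \<and> x \<in># k}"
    using keys_sum_mset_unit_monom k(1) by fastforce
qed

text \<open>
  Both \<open>from_diff\<close> and the class map are multiplicative on words; the former because all monomials of
  the image of a word are admissible.
\<close>

lemma from_diff_word:
  fixes w :: "'x nonassoc_word"
  defines "p \<equiv> \<lambda>w. eval_word diff_algebra (\<lambda>x. unit_monom {#(x, 0)#}) w :: ('x, 'k::field) diff_poly"
  shows "(\<forall>m\<in>Poly_Mapping.keys (p w). admissible m) \<and> from_diff (p w) = abs_novikov (unit_monom w)"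
proof (induction w)
  case (Letter x)
  show ?case by (simp add: p_def admissible_def from_diff_single novikov_scale_simps)
next
  case (Juxt u v)
  have p: "p (Juxt u v) = derivation (p u) * p v" by (simp add: p_def)
  have "admissible m" if m: "m \<in> Poly_Mapping.keys (derivation (p u) * p v)" for m
  proof -
    obtain a l where a: "m = a + l" "a \<in> Poly_Mapping.keys (derivation (p u))" "l \<in> Poly_Mapping.keys (p v)"
      using m keys_mult[of "derivation (p u)" "p v"] by blast
    obtain k x where "a = raise k x" "k \<in> Poly_Mapping.keys (p u)" "x \<in># k"
      using a(2) keys_derivation by blast
    then show ?thesis using a Juxt admissible_raise by blast
  qed
  moreover have "from_diff (derivation (p u) * p v) = novikov_mul (abs_novikov (unit_monom u)) (abs_novikov (unit_monom v))"
    using Juxt by (simp add: from_diff_mult)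
  ultimately show ?case
    by (simp add: p novikov_mul.abs_eq nonassoc_poly_mult_single)
qed

lemma from_diff_to_diff:
  fixes f :: "('x, 'k::field) nonassoc_poly"
  shows "from_diff (to_diff f) = abs_novikov f"
proof (induction f rule: poly_mapping_add_induct)
  case zero
  then show ?case by (simp add: to_diff_def nonassoc_algebra.eval_poly_zero[OF nonassoc_algebra_diff] zero_novikov.abs_eq)
next
  case (single w c)
  have "abs_novikov (Poly_Mapping.single w c) = novikov_scale c (abs_novikov (unit_monom w))"
    by (simp add: novikov_scale.abs_eq)
  moreover have "from_diff (eval_word diff_algebra (\<lambda>x. unit_monom {#(x, 0)#}) w :: ('x, 'k) diff_poly) =
      abs_novikov (unit_monom w)"
    using from_diff_word by blast
  ultimately show ?case
    by (simp add: to_diff_def nonassoc_algebra.eval_poly_single[OF nonassoc_algebra_diff] from_diff_scale)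
next
  case (add f g)
  then show ?case
    by (simp add: to_diff_def nonassoc_algebra.eval_poly_add[OF nonassoc_algebra_diff] from_diff_add plus_novikov.abs_eq)
qed

text \<open>
  The free Novikov algebra embeds into the differential polynomials, as \<open>from_diff\<close> is a left inverse.
\<close>

theorem to_diff_kernel:
  assumes "to_diff f = 0"
  shows "f \<in> novikov_ideal"
proof -
  have "abs_novikov f = 0" using from_diff_to_diff[of f] assms by simp
  then show ?thesis by (simp add: zero_novikov.abs_eq novikov.abs_eq_iff)
qed

section \<open>Substitution of leading terms\<close>

lemma derivation_one [simp]: "derivation 1 = 0"
  unfolding single_one[symmetric] derivation_single by (simp add: zero_multiset_def[symmetric])

lemma derivation_prod_mset:
  "derivation (\<Prod>x\<in>#m. f x) = (\<Sum>x\<in>#m. derivation (f x) * (\<Prod>y\<in>#m - {#x#}. f y))"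
proof (induction m)
  case (add a m)
  have "(\<Sum>x\<in>#m. derivation (f x) * (\<Prod>y\<in>#add_mset a m - {#x#}. f y)) =
      (\<Sum>x\<in>#m. f a * (derivation (f x) * (\<Prod>y\<in>#m - {#x#}. f y)))"
    by (intro arg_cong[where f = sum_mset] image_mset_cong) (simp add: add_mset_diff_single mult_ac)
  also have "\<dots> = f a * derivation (\<Prod>x\<in>#m. f x)"
    unfolding add.IH by (simp add: sum_mset_distrib_left multiset.map_comp comp_def)
  finally show ?case by (simp add: derivation_mult)
qed simp

text \<open>
  The homomorphism of differential algebras that sends the variable \<open>i\<close> to \<open>u i\<close>.
\<close>

definition diff_subst :: "('x \<Rightarrow> ('y, 'k::field) diff_poly) \<Rightarrow> ('x, 'k) diff_poly \<Rightarrow> ('y, 'k) diff_poly" where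
  "diff_subst u p = (\<Sum>m\<in>Poly_Mapping.keys p. scale (Poly_Mapping.lookup p m)
    (\<Prod>x\<in>#m. (derivation ^^ snd x) (u (fst x))))"

lemma diff_subst_add: "diff_subst u (p + q) = diff_subst u p + diff_subst u q"
  unfolding diff_subst_def by (rule setsum_keys_plus_distrib) (simp_all add: scale_add_left)

lemma diff_subst_zero [simp]: "diff_subst u 0 = 0"
  by (simp add: diff_subst_def)

lemma diff_subst_single: "diff_subst u (Poly_Mapping.single m c) =
    scale c (\<Prod>x\<in>#m. (derivation ^^ snd x) (u (fst x)))"
  by (simp add: diff_subst_def)

lemma diff_subst_scale: "diff_subst u (scale c p) = scale c (diff_subst u p)"
  by (induction p rule: poly_mapping_add_induct)
    (simp_all add: diff_subst_add diff_subst_single scale_scale map_scale_add)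

lemma diff_subst_sum_mset: "diff_subst u (\<Sum>i\<in>#I. f i) = (\<Sum>i\<in>#I. diff_subst u (f i))"
  by (induction I) (simp_all add: diff_subst_add)

lemma diff_subst_mult: "diff_subst u (p * q) = diff_subst u p * diff_subst u q"
proof (induction p rule: poly_mapping_add_induct)
  case (single k a)
  show ?case
    by (induction q rule: poly_mapping_add_induct)
      (simp_all add: mult_single diff_subst_single diff_subst_add distrib_left scale_mult scale_scale
        mult.commute[of a])
qed (simp_all add: diff_subst_add distrib_right)

lemma diff_subst_derivation: "diff_subst u (derivation p) = derivation (diff_subst u p)"
proof (induction p rule: poly_mapping_add_induct)
  case (single m c)
  have "diff_subst u (unit_monom (raise m x)) = derivation ((derivation ^^ snd x) (u (fst x))) *
      (\<Prod>y\<in>#m - {#x#}. (derivation ^^ snd y) (u (fst y)))" for x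
    by (simp add: diff_subst_single raise_def)
  then show ?case
    by (simp add: derivation_single diff_subst_single diff_subst_scale derivation_scale
        derivation_prod_mset diff_subst_sum_mset)
qed (simp_all add: diff_subst_add derivation_add)

text \<open>
  Both sides are homomorphisms for the Novikov product that agree on letters.
\<close>

lemma eval_poly_diff_algebra:
  "eval_poly diff_algebra u f = diff_subst u (to_diff f)"
proof -
  interpret algebra_hom diff_algebra diff_algebra "diff_subst u"
    by (intro algebra_hom.intro algebra_hom_axioms.intro nonassoc_algebra_diff)
      (simp_all add: diff_subst_add diff_subst_scale diff_subst_mult diff_subst_derivation)
  show ?thesis
    unfolding to_diff_def by (subst hom_eval_poly) (simp_all add: diff_subst_single)
qed

text \<open>
  The number of factors of positive order. It is additive and does not drop under the derivation, so
  the sets of polynomials with \<open>derived_degree_ge d\<close> form a filtration by differential ideals; leading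
  terms are those of least derived degree.
\<close>

definition derived_degree :: "('x \<times> nat) multiset \<Rightarrow> nat" where
  "derived_degree m = size (filter_mset (\<lambda>x. 0 < snd x) m)"

definition derived_degree_ge :: "nat \<Rightarrow> ('x, 'k::zero) diff_poly \<Rightarrow> bool" where
  "derived_degree_ge d p \<longleftrightarrow> (\<forall>m\<in>Poly_Mapping.keys p. d \<le> derived_degree m)"

lemma derived_degree_ge_zero [simp]: "derived_degree_ge d 0"
  by (simp add: derived_degree_ge_def)

lemma derived_degree_ge_unit_monom: "d \<le> derived_degree m \<Longrightarrow> derived_degree_ge d (unit_monom m)"
  by (simp add: derived_degree_ge_def)

lemma derived_degree_ge_add: "derived_degree_ge d p \<Longrightarrow> derived_degree_ge d q \<Longrightarrow> derived_degree_ge d (p + q)"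
  unfolding derived_degree_ge_def using keys_add by fastforce

lemma derived_degree_ge_mono: "derived_degree_ge e p \<Longrightarrow> d \<le> e \<Longrightarrow> derived_degree_ge d p"
  unfolding derived_degree_ge_def by (meson le_trans)

lemma derived_degree_ge_mult:
  fixes p q :: "('x, 'k::comm_ring_1) diff_poly"
  shows "derived_degree_ge d p \<Longrightarrow> derived_degree_ge e q \<Longrightarrow> derived_degree_ge (d + e) (p * q)"
proof -
  assume p: "derived_degree_ge d p" and q: "derived_degree_ge e q"
  have "d + e \<le> derived_degree m" if m: "m \<in> Poly_Mapping.keys (p * q)" for m
  proof -
    obtain k l where "m = k + l" "k \<in> Poly_Mapping.keys p" "l \<in> Poly_Mapping.keys q"
      using m keys_mult[of p q] by blast
    then show ?thesis using p q by (auto simp: derived_degree_ge_def derived_degree_def intro: add_mono)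
  qed
  then show ?thesis by (simp add: derived_degree_ge_def)
qed

lemma derived_degree_raise: "x \<in># k \<Longrightarrow> derived_degree k \<le> derived_degree (raise k x)"
  by (auto simp: derived_degree_def raise_def dest!: multi_member_split)

lemma derived_degree_ge_derivation: "derived_degree_ge d p \<Longrightarrow> derived_degree_ge d (derivation p)"
proof -
  assume p: "derived_degree_ge d p"
  have "d \<le> derived_degree m" if m: "m \<in> Poly_Mapping.keys (derivation p)" for m
  proof -
    obtain k x where k: "m = raise k x" "k \<in> Poly_Mapping.keys p" "x \<in># k"
      using m keys_derivation[of p] by blast
    then have "d \<le> derived_degree k" using p by (simp add: derived_degree_ge_def)
    also have "\<dots> \<le> derived_degree m" unfolding k(1) by (rule derived_degree_raise[OF k(3)])
    finally show ?thesis .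
  qed
  then show ?thesis by (simp add: derived_degree_ge_def)
qed

lemma derived_degree_ge_lookup: "derived_degree_ge d p \<Longrightarrow> derived_degree m < d \<Longrightarrow> Poly_Mapping.lookup p m = 0"
  unfolding derived_degree_ge_def by (meson in_keys_iff not_less)

text \<open>
  The monomial \<open>x\<^sup>a x\<^sup>(\<^sup>b\<^sup>)\<close> in the single variable \<open>0\<close>.
\<close>

definition lead_monomial :: "nat \<Rightarrow> nat \<Rightarrow> (nat \<times> nat) multiset" where
  "lead_monomial a b = add_mset (0, b) (replicate_mset a (0, 0))"

lemma derived_degree_lead: "0 < b \<Longrightarrow> derived_degree (lead_monomial a b) = 1"
  by (simp add: derived_degree_def lead_monomial_def)

lemma derivation_lead:
  "derivation (unit_monom (lead_monomial a b) :: (nat, 'k::comm_ring_1) diff_poly) =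
    unit_monom (lead_monomial a (Suc b)) + scale (of_nat a) (unit_monom (raise (lead_monomial a b) (0, 0)))"
proof -
  have "(\<Sum>x\<in>#replicate_mset a y. f x) = scale (of_nat a) (f y)"
    for y and f :: "nat \<times> nat \<Rightarrow> (nat, 'k) diff_poly"
    by (induction a) (simp_all add: scale_add_left)
  moreover have "raise (lead_monomial a b) (0, b) = lead_monomial a (Suc b)" by (simp add: raise_def lead_monomial_def)
  ultimately show ?thesis by (simp add: derivation_single lead_monomial_def del: map_single)
qed

text \<open>
  If the derivation hits one of the factors \<open>x\<close> of \<open>x\<^sup>a x\<^sup>(\<^sup>b\<^sup>)\<close>, a second derived factor arises.
\<close>

lemma derivation_pow_lead:
  assumes "0 < b"
  shows "derived_degree_ge 2 ((derivation ^^ j) (unit_monom (lead_monomial a b)) - unit_monom (lead_monomial a (b + j)) :: (nat, 'k::field) diff_poly)"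
proof (induction j)
  case (Suc j)
  define r :: "(nat, 'k) diff_poly"
    where "r = (derivation ^^ j) (unit_monom (lead_monomial a b)) - unit_monom (lead_monomial a (b + j))"
  have "derived_degree_ge 2 (scale (of_nat a) (unit_monom (raise (lead_monomial a (b + j)) (0, 0)) :: (nat, 'k) diff_poly))"
  proof (cases a)
    case (Suc n)
    have "raise (lead_monomial a (b + j)) (0, 0) = add_mset (0, 1) (lead_monomial n (b + j))"
      using assms by (simp add: Suc raise_def lead_monomial_def)
    then have "derived_degree (raise (lead_monomial a (b + j)) (0, 0)) = 2"
      using assms derived_degree_lead[of "b + j" n] by (simp add: derived_degree_def)
    then show ?thesis by (simp add: derived_degree_ge_def)
  qed simp
  moreover have "derived_degree_ge 2 (derivation r :: (nat, 'k) diff_poly)"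
    using Suc by (simp add: derived_degree_ge_derivation r_def)
  moreover have "(derivation ^^ Suc j) (unit_monom (lead_monomial a b)) - unit_monom (lead_monomial a (b + Suc j)) =
      scale (of_nat a) (unit_monom (raise (lead_monomial a (b + j)) (0, 0))) + (derivation r :: (nat, 'k) diff_poly)"
  proof -
    have "(derivation ^^ j) (unit_monom (lead_monomial a b)) = unit_monom (lead_monomial a (b + j)) + (r :: (nat, 'k) diff_poly)"
      by (simp add: r_def)
    then show ?thesis by (simp add: derivation_add derivation_lead del: map_single)
  qed
  ultimately show ?case by (simp only: derived_degree_ge_add)
qed simp

text \<open>
  The leading term of a product is the product of the leading terms.
\<close>

lemma derived_degree_ge_prod:
  fixes g :: "'a \<Rightarrow> (nat, 'k::field) diff_poly"
  assumes "\<And>x. x \<in># m \<Longrightarrow> derived_degree_ge 2 (g x - unit_monom (l x))" "\<And>x. x \<in># m \<Longrightarrow> derived_degree (l x) = 1"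
  shows "derived_degree_ge (Suc (size m)) ((\<Prod>x\<in>#m. g x) - unit_monom (\<Sum>x\<in>#m. l x))"
    and "derived_degree_ge (size m) (\<Prod>x\<in>#m. g x)"
  using assms
proof (induction m)
  case empty
  {
    case 1
    then show ?case by (simp add: zero_multiset_def[symmetric])
  next
    case 2
    then show ?case by (simp add: derived_degree_ge_def)
  }
next
  case (add a m)
  have IH: "derived_degree_ge (Suc (size m)) ((\<Prod>x\<in>#m. g x) - unit_monom (\<Sum>x\<in>#m. l x))"
    "derived_degree_ge (size m) (\<Prod>x\<in>#m. g x)" if "\<And>x. x \<in># add_mset a m \<Longrightarrow> derived_degree_ge 2 (g x - unit_monom (l x))"
      "\<And>x. x \<in># add_mset a m \<Longrightarrow> derived_degree (l x) = 1"
    using add.IH that by simp_all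
  {
    case 1
    have "derived_degree_ge (2 + size m) ((g a - unit_monom (l a)) * (\<Prod>x\<in>#m. g x))"
      using 1 IH by (intro derived_degree_ge_mult) simp_all
    moreover have "derived_degree_ge (1 + Suc (size m)) (unit_monom (l a) * ((\<Prod>x\<in>#m. g x) - unit_monom (\<Sum>x\<in>#m. l x)))"
      using 1 IH by (intro derived_degree_ge_mult derived_degree_ge_unit_monom) simp_all
    moreover have "(\<Prod>x\<in>#add_mset a m. g x) - unit_monom (\<Sum>x\<in>#add_mset a m. l x) =
        (g a - unit_monom (l a)) * (\<Prod>x\<in>#m. g x) + unit_monom (l a) * ((\<Prod>x\<in>#m. g x) - unit_monom (\<Sum>x\<in>#m. l x))"
      by (simp add: algebra_simps monom_mult)
    ultimately show ?case by (simp add: derived_degree_ge_add)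
  next
    case 2
    have "derived_degree_ge 1 (g a - unit_monom (l a) + unit_monom (l a))"
      using 2 by (intro derived_degree_ge_add derived_degree_ge_unit_monom) (simp_all add: derived_degree_ge_mono[of 2])
    then have "derived_degree_ge (1 + size m) (g a * (\<Prod>x\<in>#m. g x))"
      using 2 IH by (intro derived_degree_ge_mult) simp_all
    then show ?case by simp
  }
qed

text \<open>
  Let \<open>m0\<close> be a monomial of \<open>p\<close> with the least number of factors. After the substitution its leading
  term \<open>T\<close> has derived degree \<open>size m0\<close>; other monomials of \<open>p\<close> contribute to \<open>T\<close> only through their own
  leading terms. These are distinct, because \<open>x\<^sup>(\<^sup>N\<^sup>i\<^sup>+\<^sup>j\<^sup>)\<close> with \<open>N i = (i + 1) K\<close> and \<open>j < K\<close> determines \<open>i\<close>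
  and \<open>j\<close> by division by \<open>K\<close>. The exponents \<open>N i\<close> start at \<open>K\<close> since \<open>x\<^sup>(\<^sup>0\<^sup>)\<close> is not a derived factor.
\<close>

lemma diff_subst_faithful:
  fixes p :: "(nat, 'k::field) diff_poly"
  assumes K: "\<And>m x. m \<in> Poly_Mapping.keys p \<Longrightarrow> x \<in># m \<Longrightarrow> snd x < K" and "0 < K" and "p \<noteq> 0"
  defines "N \<equiv> \<lambda>i. Suc i * K"
  shows "diff_subst (\<lambda>i. unit_monom (lead_monomial (N i) (N i))) p \<noteq> 0"
proof -
  define L where "L x = lead_monomial (N (fst x)) (N (fst x) + snd x)" for x
  define G where "G m = (\<Prod>x\<in>#m. (derivation ^^ snd x) (unit_monom (lead_monomial (N (fst x)) (N (fst x))) :: (nat, 'k) diff_poly))"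
    for m
  have N: "0 < N i" for i using \<open>0 < K\<close> by (simp add: N_def)
  have lead_G: "derived_degree_ge (Suc (size m)) (G m - unit_monom (\<Sum>x\<in>#m. L x))" for m
    unfolding G_def L_def using N by (intro derived_degree_ge_prod derivation_pow_lead derived_degree_lead) simp_all
  have filter_L: "filter_mset (\<lambda>x. 0 < snd x) (\<Sum>x\<in>#m. L x) = image_mset (\<lambda>x. (0, N (fst x) + snd x)) m" for m
    using N by (induction m) (simp_all add: L_def lead_monomial_def)
  have inj: "m = m'" if "(\<Sum>x\<in>#m. L x) = (\<Sum>x\<in>#m'. L x)" "m \<in> Poly_Mapping.keys p" "m' \<in> Poly_Mapping.keys p" for m m'
  proof -
    define decode where "decode y = (snd y div K - 1, snd y mod K)" for y :: "nat \<times> nat"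
    have "image_mset decode (image_mset (\<lambda>x. (0, N (fst x) + snd x)) m) = m" if "m \<in> Poly_Mapping.keys p" for m
    proof -
      have "decode (0, N (fst x) + snd x) = x" if "x \<in># m" for x
        using K[OF \<open>m \<in> Poly_Mapping.keys p\<close> that] div_mult_self3[of K "Suc (fst x)" "snd x"]
          mod_mult_self3[of "Suc (fst x)" K "snd x"]
        by (simp add: decode_def N_def del: mult_Suc)
      then show ?thesis by (simp add: multiset.map_comp comp_def cong: image_mset_cong)
    qed
    then show ?thesis using that filter_L by metis
  qed
  obtain m0 where m0: "m0 \<in> Poly_Mapping.keys p" "\<And>m. m \<in> Poly_Mapping.keys p \<Longrightarrow> size m0 \<le> size m"
    using \<open>p \<noteq> 0\<close> ex_has_least_nat[of "\<lambda>m. m \<in> Poly_Mapping.keys p" _ size] by (metis ex_in_conv keys_eq_empty)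
  define T where "T = (\<Sum>x\<in>#m0. L x)"
  have "derived_degree T = size m0" unfolding T_def derived_degree_def filter_L by simp
  have coeff: "Poly_Mapping.lookup (G m) T = (if m = m0 then 1 else 0)" if m: "m \<in> Poly_Mapping.keys p" for m
  proof -
    have "Poly_Mapping.lookup (G m - unit_monom (\<Sum>x\<in>#m. L x)) T = 0"
      using m0(2)[OF m] \<open>derived_degree T = size m0\<close> by (intro derived_degree_ge_lookup[OF lead_G]) simp
    then have "Poly_Mapping.lookup (G m) T = Poly_Mapping.lookup (unit_monom (\<Sum>x\<in>#m. L x)) T"
      by (simp add: lookup_minus)
    also have "\<dots> = (if m = m0 then 1 else 0)"
      using inj[OF _ m m0(1)] by (auto simp: T_def lookup_single when_def)
    finally show ?thesis .
  qed
  have "Poly_Mapping.lookup (diff_subst (\<lambda>i. unit_monom (lead_monomial (N i) (N i))) p) T =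
      (\<Sum>m\<in>Poly_Mapping.keys p. Poly_Mapping.lookup p m * Poly_Mapping.lookup (G m) T)"
    by (simp add: diff_subst_def lookup_sum G_def)
  also have "\<dots> = (\<Sum>m\<in>Poly_Mapping.keys p. if m = m0 then Poly_Mapping.lookup p m else 0)"
    by (intro sum.cong) (simp_all add: coeff)
  also have "\<dots> = Poly_Mapping.lookup p m0" using m0(1) by simp
  also have "\<dots> \<noteq> 0" using m0(1) by (simp add: in_keys_iff)
  finally show ?thesis by auto
qed

section \<open>The variety generated by the one-generated free algebra\<close>

text \<open>
  Elements of the algebra generated by \<open>x\<close> whose differential polynomials are \<open>x\<^sup>n x\<^sup>(\<^sup>n\<^sup>)\<close>. Since
  \<open>d(x\<^sup>n x\<^sup>(\<^sup>n\<^sup>)) x = x\<^sup>n\<^sup>+\<^sup>1 x\<^sup>(\<^sup>n\<^sup>+\<^sup>1\<^sup>) + n x\<^sup>n x' x\<^sup>(\<^sup>n\<^sup>)\<close>, subtracting \<open>n\<close> times the product of \<open>x\<close> and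
  \<open>x\<^sup>n x\<^sup>(\<^sup>n\<^sup>)\<close> leads to the next element.
\<close>

primrec lead_poly :: "nat \<Rightarrow> (nat, 'k::field) nonassoc_poly" where
  "lead_poly 0 = unit_monom (Letter 0)"
| "lead_poly (Suc n) = nonassoc_poly_mult (lead_poly n) (unit_monom (Letter 0)) +
    scale (- of_nat n) (nonassoc_poly_mult (unit_monom (Letter 0)) (lead_poly n))"

lemma lead_poly_closed: "lead_poly n \<in> carrier (free_nonassoc_algebra {..<1} :: ('k::field, _) module)"
proof -
  interpret F: nonassoc_algebra "free_nonassoc_algebra {..<1} :: ('k, (nat, 'k) nonassoc_poly) module"
    by (rule nonassoc_algebra_free)
  have x: "unit_monom (Letter 0) \<in> carrier (free_nonassoc_algebra {..<1} :: ('k, (nat, 'k) nonassoc_poly) module)"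
    by simp
  show ?thesis
  proof (induction n)
    case (Suc n)
    show ?case
      using F.M.a_closed[OF F.mult_closed[OF Suc x] F.smult_mem[OF F.mult_closed[OF x Suc]]] by simp
  qed (use x in simp)
qed

lemma to_diff_simps:
  fixes f g :: "('x, 'k::field) nonassoc_poly"
  shows "to_diff (f + g) = to_diff f + to_diff g" "to_diff (scale c f) = scale c (to_diff f)"
    "to_diff (nonassoc_poly_mult f g) = derivation (to_diff f) * to_diff g"
    "to_diff (unit_monom (Letter x) :: ('x, 'k) nonassoc_poly) = unit_monom {#(x, 0)#}"
proof -
  interpret h: algebra_hom "free_nonassoc_algebra UNIV" diff_algebra "to_diff :: ('x, 'k) nonassoc_poly \<Rightarrow> _"
    by (rule to_diff_hom)
  show "to_diff (f + g) = to_diff f + to_diff g" "to_diff (scale c f) = scale c (to_diff f)"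
    "to_diff (nonassoc_poly_mult f g) = derivation (to_diff f) * to_diff g"
    using h.hom_add[of f g] h.hom_smult[of f c] h.hom_mult[of f g] by simp_all
  show "to_diff (unit_monom (Letter x) :: ('x, 'k) nonassoc_poly) = unit_monom {#(x, 0)#}"
    by (simp add: to_diff_def h.B.eval_poly_single)
qed

lemma to_diff_lead_poly: "to_diff (lead_poly n :: (nat, 'k::field) nonassoc_poly) = unit_monom (lead_monomial n n)"
proof (induction n)
  case 0
  then show ?case by (simp add: to_diff_simps lead_monomial_def)
next
  case (Suc n)
  have "raise (lead_monomial n n) (0, 0) + {#(0, 0)#} = {#(0, 1)#} + lead_monomial n n" if "0 < n"
    using that by (cases n) (simp_all add: raise_def lead_monomial_def add_mset_commute)
  then have r: "scale (of_nat n) (unit_monom (raise (lead_monomial n n) (0, 0) + {#(0, 0)#})) =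
      (scale (of_nat n) (unit_monom ({#(0, 1)#} + lead_monomial n n)) :: (nat, 'k) diff_poly)"
    by (cases "n = 0") (simp_all del: map_single)
  have dx: "derivation (unit_monom {#(0, 0)#}) = (unit_monom {#(0, 1)#} :: (nat, 'k) diff_poly)"
    by (simp add: derivation_single raise_def)
  have "to_diff (lead_poly (Suc n) :: (nat, 'k) nonassoc_poly) =
      (unit_monom (lead_monomial n (Suc n)) + scale (of_nat n) (unit_monom (raise (lead_monomial n n) (0, 0)))) * unit_monom {#(0, 0)#}
      + scale (- of_nat n) (unit_monom {#(0, 1)#} * unit_monom (lead_monomial n n))"
    by (simp add: to_diff_simps Suc derivation_lead dx del: map_single)
  also have "\<dots> = unit_monom (lead_monomial n (Suc n) + {#(0, 0)#})
      + scale (of_nat n) (unit_monom ({#(0, 1)#} + lead_monomial n n)) + scale (- of_nat n) (unit_monom ({#(0, 1)#} + lead_monomial n n))"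
    by (simp only: distrib_right scale_mult monom_mult r)
  also have "\<dots> = unit_monom (lead_monomial n (Suc n) + {#(0, 0)#})"
    unfolding add.assoc scale_add_left[symmetric] by simp
  also have "lead_monomial n (Suc n) + {#(0, 0)#} = lead_monomial (Suc n) (Suc n)" by (simp add: lead_monomial_def add_mset_commute)
  finally show ?case .
qed

text \<open>
  Evaluate the identity at the classes of the elements \<open>lead_poly (N i)\<close>. The result lies in the
  ideal of the relators, which \<open>to_diff\<close> kills; so \<open>to_diff f\<close> vanishes under the substitution of
  \<open>diff_subst_faithful\<close>.
\<close>

lemma to_diff_identity:
  fixes f :: "(nat, 'k::field) nonassoc_poly"
  assumes f: "satisfies_identity (free_novikov_algebra {..<1} :: ('k, (nat, 'k) nonassoc_poly set) module) f"
  shows "to_diff f = 0"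
proof (rule ccontr)
  assume nz: "to_diff f \<noteq> 0"
  let ?F = "free_nonassoc_algebra {..<1} :: ('k, (nat, 'k) nonassoc_poly) module"
  let ?I = "generated_ideal ?F (novikov_relators ?F)"
  let ?Q = "quotient_algebra ?F ?I"
  interpret F: nonassoc_algebra ?F by (rule nonassoc_algebra_free)
  note I = F.algebra_ideal_generated(1)[OF F.novikov_relators_closed]
  interpret q: algebra_hom ?F ?Q "\<lambda>x. ?I +>\<^bsub>?F\<^esub> x"
    by (rule quotient_algebra_hom[OF nonassoc_algebra_free I])
  interpret d: algebra_hom ?F diff_algebra to_diff by (rule to_diff_hom)
  define orders where "orders = insert 0 (snd ` (\<Union>m\<in>Poly_Mapping.keys (to_diff f). set_mset m))"
  define K where "K = Suc (Max orders)"
  have "finite orders" by (simp add: orders_def)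
  have K: "snd x < K" if "m \<in> Poly_Mapping.keys (to_diff f)" "x \<in># m" for m x
  proof -
    have "snd x \<in> orders" using that by (auto simp: orders_def)
    then show ?thesis using Max_ge[OF \<open>finite orders\<close>] by (simp add: K_def less_Suc_eq_le)
  qed
  define r where "r i = (lead_poly (Suc i * K) :: (nat, 'k) nonassoc_poly)" for i
  have r: "r i \<in> carrier ?F" for i unfolding r_def by (rule lead_poly_closed)
  have "?I +>\<^bsub>?F\<^esub> eval_poly ?F r f = eval_poly ?Q (\<lambda>i. ?I +>\<^bsub>?F\<^esub> r i) f"
    by (rule q.hom_eval_poly[OF r])
  also have "\<dots> = \<zero>\<^bsub>?Q\<^esub>"
    using f[unfolded satisfies_identity_def free_novikov_algebra_def, rule_format,
        of "\<lambda>i. ?I +>\<^bsub>?F\<^esub> r i"] q.hom_closed[OF r] by simp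
  finally have "eval_poly ?F r f \<in> ?I"
    by (rule quotient_kernel[OF nonassoc_algebra_free I F.eval_poly_closed[of r, OF r]])
  then have "to_diff (eval_poly ?F r f) = \<zero>\<^bsub>diff_algebra\<^esub>"
    by (rule d.novikov_ideal_in_kernel[OF diff_algebra_in_variety])
  then have "eval_poly diff_algebra (\<lambda>i. to_diff (r i)) f = 0"
    using d.hom_eval_poly[of r, OF r] by simp
  then have "diff_subst (\<lambda>i. unit_monom (lead_monomial (Suc i * K) (Suc i * K))) (to_diff f) = 0"
    unfolding eval_poly_diff_algebra r_def to_diff_lead_poly .
  moreover have "diff_subst (\<lambda>i. unit_monom (lead_monomial (Suc i * K) (Suc i * K))) (to_diff f) \<noteq> 0"
    using K nz by (intro diff_subst_faithful) (simp_all add: K_def)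
  ultimately show False by contradiction
qed

lemma novikov_identity_holds:
  fixes A :: "('k::field, 'a) module"
  assumes "A \<in> novikov_variety" "to_diff f = 0"
  shows "satisfies_identity A f"
  unfolding satisfies_identity_def
proof (intro allI impI)
  fix \<rho> :: "nat \<Rightarrow> 'a" assume \<rho>: "\<forall>i. \<rho> i \<in> carrier A"
  interpret algebra_hom "free_nonassoc_algebra UNIV" A "eval_poly A \<rho>"
    using \<rho> novikov_varietyD(1)[OF assms(1)] by (intro eval_poly_hom) auto
  show "eval_poly A \<rho> f = \<zero>\<^bsub>A\<^esub>"
    using novikov_ideal_in_kernel[OF assms(1), folded novikov_ideal_def] to_diff_kernel[OF assms(2)] by simp
qed

text \<open>
  The Novikov identities are themselves given by nonassociative polynomials, the relators in three
  letters, hence they pass from \<open>B\<close> to all algebras that satisfy the identities of \<open>B\<close>.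
\<close>

lemma variety_generated_by_novikov:
  fixes B :: "('k::field, 'b) module"
  assumes "B \<in> novikov_variety"
  shows "variety_generated_by B \<subseteq> (novikov_variety :: ('k, 'a) module set)"
proof
  fix A :: "('k, 'a) module" assume "A \<in> variety_generated_by B"
  then have A: "nonassoc_algebra A" and ids: "\<And>f. satisfies_identity B f \<Longrightarrow> satisfies_identity A f"
    by (auto simp: variety_generated_by_def)
  interpret A: nonassoc_algebra A by fact
  let ?F = "free_nonassoc_algebra UNIV :: ('k, (nat, 'k) nonassoc_poly) module"
  interpret F: nonassoc_algebra ?F by (rule nonassoc_algebra_free)
  have relator: "eval_poly A \<rho> r = \<zero>\<^bsub>A\<^esub>" if "r \<in> novikov_relators ?F" "\<And>i. \<rho> i \<in> carrier A" for r \<rho>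
  proof -
    have r: "r \<in> generated_ideal ?F (novikov_relators ?F)"
      using that(1) F.algebra_ideal_generated(2)[OF F.novikov_relators_closed] by blast
    have "satisfies_identity B r"
      unfolding satisfies_identity_def
    proof (intro allI impI)
      fix \<sigma> :: "nat \<Rightarrow> 'b" assume \<sigma>: "\<forall>i. \<sigma> i \<in> carrier B"
      interpret algebra_hom ?F B "eval_poly B \<sigma>"
        using \<sigma> novikov_varietyD(1)[OF assms] by (intro eval_poly_hom) auto
      show "eval_poly B \<sigma> r = \<zero>\<^bsub>B\<^esub>" by (rule novikov_ideal_in_kernel[OF assms r])
    qed
    then show ?thesis using ids that(2) unfolding satisfies_identity_def by blast
  qed
  have "(x \<otimes>\<^bsub>A\<^esub> y) \<otimes>\<^bsub>A\<^esub> z \<ominus>\<^bsub>A\<^esub> x \<otimes>\<^bsub>A\<^esub> (y \<otimes>\<^bsub>A\<^esub> z) =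
        (x \<otimes>\<^bsub>A\<^esub> z) \<otimes>\<^bsub>A\<^esub> y \<ominus>\<^bsub>A\<^esub> x \<otimes>\<^bsub>A\<^esub> (z \<otimes>\<^bsub>A\<^esub> y) \<and>
      x \<otimes>\<^bsub>A\<^esub> (y \<otimes>\<^bsub>A\<^esub> z) = y \<otimes>\<^bsub>A\<^esub> (x \<otimes>\<^bsub>A\<^esub> z)"
    if xyz: "x \<in> carrier A" "y \<in> carrier A" "z \<in> carrier A" for x y z
  proof -
    define \<rho> where "\<rho> i = (if i = 0 then x else if i = 1 then y else z)" for i :: nat
    have \<rho>: "\<rho> i \<in> carrier A" for i using xyz by (simp add: \<rho>_def)
    interpret h: algebra_hom ?F A "eval_poly A \<rho>" by (rule eval_poly_hom[of A \<rho>, OF A \<rho>])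
    define a b c where "a = (unit_monom (Letter 0) :: (nat, 'k) nonassoc_poly)"
      and "b = (unit_monom (Letter 1) :: (nat, 'k) nonassoc_poly)"
      and "c = (unit_monom (Letter 2) :: (nat, 'k) nonassoc_poly)"
    have abc: "a \<in> carrier ?F" "b \<in> carrier ?F" "c \<in> carrier ?F" by simp_all
    have eval: "eval_poly A \<rho> a = x" "eval_poly A \<rho> b = y" "eval_poly A \<rho> c = z"
      using A.eval_poly_single[of \<rho>, OF \<rho>] A.smult_one[simplified] xyz
      by (simp_all add: a_def b_def c_def \<rho>_def)
    note homs = h.hom_minus h.hom_mult F.mult_closed F.M.minus_closed abc eval
    have "((a \<otimes>\<^bsub>?F\<^esub> b) \<otimes>\<^bsub>?F\<^esub> c \<ominus>\<^bsub>?F\<^esub> a \<otimes>\<^bsub>?F\<^esub> (b \<otimes>\<^bsub>?F\<^esub> c)) \<ominus>\<^bsub>?F\<^esub>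
        ((a \<otimes>\<^bsub>?F\<^esub> c) \<otimes>\<^bsub>?F\<^esub> b \<ominus>\<^bsub>?F\<^esub> a \<otimes>\<^bsub>?F\<^esub> (c \<otimes>\<^bsub>?F\<^esub> b)) \<in> novikov_relators ?F"
      unfolding novikov_relators_def using abc by blast
    from relator[of _ \<rho>, OF this \<rho>]
    have 1: "((x \<otimes>\<^bsub>A\<^esub> y) \<otimes>\<^bsub>A\<^esub> z \<ominus>\<^bsub>A\<^esub> x \<otimes>\<^bsub>A\<^esub> (y \<otimes>\<^bsub>A\<^esub> z)) \<ominus>\<^bsub>A\<^esub>
        ((x \<otimes>\<^bsub>A\<^esub> z) \<otimes>\<^bsub>A\<^esub> y \<ominus>\<^bsub>A\<^esub> x \<otimes>\<^bsub>A\<^esub> (z \<otimes>\<^bsub>A\<^esub> y)) = \<zero>\<^bsub>A\<^esub>"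
      by (simp only: homs)
    have "a \<otimes>\<^bsub>?F\<^esub> (b \<otimes>\<^bsub>?F\<^esub> c) \<ominus>\<^bsub>?F\<^esub> b \<otimes>\<^bsub>?F\<^esub> (a \<otimes>\<^bsub>?F\<^esub> c) \<in> novikov_relators ?F"
      unfolding novikov_relators_def using abc by blast
    from relator[of _ \<rho>, OF this \<rho>]
    have 2: "x \<otimes>\<^bsub>A\<^esub> (y \<otimes>\<^bsub>A\<^esub> z) \<ominus>\<^bsub>A\<^esub> y \<otimes>\<^bsub>A\<^esub> (x \<otimes>\<^bsub>A\<^esub> z) = \<zero>\<^bsub>A\<^esub>"
      by (simp only: homs)
    show ?thesis
      using A.minus_eq_zeroD[OF 1] A.minus_eq_zeroD[OF 2] xyz by (simp add: A.mult_closed A.M.minus_closed)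
  qed
  then show "A \<in> novikov_variety" unfolding novikov_variety_def using A by blast
qed

lemma variety_free_novikov_one:
  "variety_generated_by (free_novikov_algebra {..<1} :: ('k::field, (nat, 'k) nonassoc_poly set) module)
    = (novikov_variety :: ('k, 'a) module set)"
proof
  show "variety_generated_by (free_novikov_algebra {..<1} :: ('k, (nat, 'k) nonassoc_poly set) module)
    \<subseteq> (novikov_variety :: ('k, 'a) module set)"
    by (rule variety_generated_by_novikov[OF free_novikov_in_variety])
  show "novikov_variety \<subseteq> (variety_generated_by
      (free_novikov_algebra {..<1} :: ('k, (nat, 'k) nonassoc_poly set) module) :: ('k, 'a) module set)"
    unfolding variety_generated_by_def
    using novikov_varietyD(1) novikov_identity_holds to_diff_identity by blast
qed

theorem corollary5:
  shows "novikov_base_rank TYPE('k::field_char_0) TYPE('a) = 1"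
proof -
  let ?S = "{enat n | n. n \<ge> 1 \<and>
    variety_generated_by (free_novikov_algebra {..<n} :: ('k, (nat, 'k) nonassoc_poly set) module)
      = (novikov_variety :: ('k, 'a) module set)}"
  have "1 \<in> ?S"
    using variety_free_novikov_one[where ?'k = 'k and ?'a = 'a] by (auto simp: one_enat_def)
  moreover have "1 \<le> s" if "s \<in> ?S" for s
    using that by (auto simp: one_enat_def)
  ultimately have "Inf ?S = 1" by (intro antisym Inf_lower Inf_greatest)
  then show ?thesis by (simp only: novikov_base_rank_def)
qed

end
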